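(* Let $\mu$ be a finite positive Borel measure on $\mathbb{T}$ and let $E$ be a closed subset of $\mathbb{T}$ of Lebesgue measure zero. Suppose that $\rho_{\mu,E}\le\psi$, where $\psi$ is an $\alpha$-admissible function for some $\alpha<2$. If $$\int_0^\pi\frac{dt}{M_{\psi,E}(t)}=+\infty,$$ then $c_\mu(E)=0$.
   Context: $\mathbb{T}$ is the unit circle; $L^2(\mathbb{T})$ is taken with respect to $dt/2\pi$. Capacity: for $f\in L^2(\mathbb{T})$ put $$\mathcal{D}_\mu(f)=\int_{\mathbb{T}}\left(\int_{\mathbb{T}}\frac{|f(e^{it})-f(\xi)|^2}{|e^{it}-\xi|^2}\frac{dt}{2\pi}\right)d\mu(\xi),$$ where $f(\xi)$ is the non-tangential limit at $\xi$ of the Poisson integral of $f$ (the inner integral is $+\infty$ where this limit does not exist), and $\mathcal{D}^h(\mu)=\{f\in L^2(\mathbb{T}):\|f\|_\mu^2:=\|f\|_{L^2(\mathbb{T})}^2+\mathcal{D}_\mu(f)<\infty\}$. For $U\subset\mathbb{T}$ open, $c_\mu(U)=\inf\{\|u\|_\mu^2: u\in\mathcal{D}^h(\mu),\ u\ge0,\ u\ge1\text{ a.e. on }U\}$; for any $F\subset\mathbb{T}$, $c_\mu(F)=\inf\{c_\mu(U):U\text{ open},\ F\subset U\}$. Local modulus of continuity: $\rho_{\mu,E}(t)=\sup\{\mu(\zeta e^{-it},\zeta e^{it}):\zeta\in E\}$, where $(\zeta e^{-it},\zeta e^{it})=\{\zeta e^{i\theta}:|\theta|<t\}$. Geometry of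 $E$: $d$ is arc-length distance on $\mathbb{T}$, $E_t=\{\zeta\in\mathbb{T}:d(\zeta,E)\le t\}$, $|E_t|$ is its arc-length Lebesgue measure, and $N_E(t)=2\sum_j\mathbf{1}_{\{|I_j|>2t\}}$, where $(I_j)$ are the connected components of $\mathbb{T}\setminus E$ and $|I_j|$ their arc lengths. $\psi$ denotes a positive increasing function on $(0,2\pi)$ with $\psi(0)=0$ (i.e. $\psi(0^+)=0$). It is called $\alpha$-admissible ($\alpha>0$) if $\psi$ is concave or convex, and $\psi(s)/s^\alpha$ is decreasing. Finally $$M_{\psi,E}(s)=\max\left(\int_0^s\frac{\psi(t)}{t}N_E(t)\,dt,\ \frac{\psi(s)}{s}|E_s|\right).$$ *)

theory Defs
  imports "HOL-Analysis.Analysis"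
begin

abbreviation circle :: "complex set" where
  "circle \<equiv> sphere 0 1"

definition arc_length :: "complex measure" where
  "arc_length = distr (restrict_space lborel {0..<2*pi}) (restrict_space borel circle) cis"

text \<open>The normalised measure $dt/2\pi$.\<close>

definition circle_measure :: "complex measure" where
  "circle_measure = scale_measure (ennreal (1 / (2*pi))) arc_length"

text \<open>Elements of $L^2$ are represented by Borel functions; every notion below is invariant under
  changing the representative on a null set.\<close>

definition L2_circle :: "(complex \<Rightarrow> complex) set" where
  "L2_circle = {f \<in> borel_measurable circle_measure.
     (\<integral>\<^sup>+z. ennreal ((norm (f z))\<^sup>2) \<partial>circle_measure) < \<infinity>}"

definition poisson_integral :: "(complex \<Rightarrow> complex) \<Rightarrow> complex \<Rightarrow> complex" where
  "poisson_integral f z =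
     (LINT \<zeta>|circle_measure. ((1 - (norm z)\<^sup>2) / (norm (\<zeta> - z))\<^sup>2) *\<^sub>R f \<zeta>)"

definition stolz_region :: "real \<Rightarrow> complex \<Rightarrow> complex set" where
  "stolz_region \<kappa> \<xi> = {z. norm z < 1 \<and> norm (z - \<xi>) < \<kappa> * (1 - norm z)}"

definition has_nontangential_limit :: "(complex \<Rightarrow> complex) \<Rightarrow> complex \<Rightarrow> complex \<Rightarrow> bool" where
  "has_nontangential_limit F \<xi> l \<longleftrightarrow> (\<forall>\<kappa>>1. (F \<longlongrightarrow> l) (at \<xi> within stolz_region \<kappa> \<xi>))"

definition local_dirichlet :: "(complex \<Rightarrow> complex) \<Rightarrow> complex \<Rightarrow> ennreal" where
  "local_dirichlet f \<xi> =
     (if \<exists>l. has_nontangential_limit (poisson_integral f) \<xi> l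
      then (let l = (THE l. has_nontangential_limit (poisson_integral f) \<xi> l)
            in \<integral>\<^sup>+z. ennreal ((norm (f z - l))\<^sup>2 / (norm (z - \<xi>))\<^sup>2) \<partial>circle_measure)
      else \<infinity>)"

definition dirichlet_integral :: "complex measure \<Rightarrow> (complex \<Rightarrow> complex) \<Rightarrow> ennreal" where
  "dirichlet_integral \<mu> f = (\<integral>\<^sup>+\<xi>. local_dirichlet f \<xi> \<partial>\<mu>)"

definition dirichlet_norm_sq :: "complex measure \<Rightarrow> (complex \<Rightarrow> complex) \<Rightarrow> ennreal" where
  "dirichlet_norm_sq \<mu> f =
     (\<integral>\<^sup>+z. ennreal ((norm (f z))\<^sup>2) \<partial>circle_measure) + dirichlet_integral \<mu> f"

definition harmonic_dirichlet_space :: "complex measure \<Rightarrow> (complex \<Rightarrow> complex) set" where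
  "harmonic_dirichlet_space \<mu> = {f \<in> L2_circle. dirichlet_norm_sq \<mu> f < \<infinity>}"

definition open_capacity :: "complex measure \<Rightarrow> complex set \<Rightarrow> ennreal" where
  "open_capacity \<mu> U = Inf {dirichlet_norm_sq \<mu> u |u.
     u \<in> harmonic_dirichlet_space \<mu> \<and>
     (AE z in circle_measure. u z \<in> \<real> \<and> 0 \<le> Re (u z)) \<and>
     (AE z in circle_measure. z \<in> U \<longrightarrow> 1 \<le> Re (u z))}"

definition capacity :: "complex measure \<Rightarrow> complex set \<Rightarrow> ennreal" where
  "capacity \<mu> F = Inf {open_capacity \<mu> U |U. openin (top_of_set circle) U \<and> F \<subseteq> U}"

definition open_arc :: "complex \<Rightarrow> real \<Rightarrow> complex set" where
  "open_arc \<zeta> t = {\<zeta> * cis \<theta> |\<theta>. \<bar>\<theta>\<bar> < t}"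

definition local_modulus :: "complex measure \<Rightarrow> complex set \<Rightarrow> real \<Rightarrow> ennreal" where
  "local_modulus \<mu> E t = (SUP \<zeta>\<in>E. emeasure \<mu> (open_arc \<zeta> t))"

text \<open>Meaningful for points of the circle only; the values of \<^const>\<open>Arg\<close> lie in $(-\pi,\pi]$.\<close>

definition arc_dist :: "complex \<Rightarrow> complex \<Rightarrow> real" where
  "arc_dist z w = \<bar>Arg (z / w)\<bar>"

text \<open>The infimum is taken in \<^typ>\<open>ennreal\<close>, so that the distance to the empty set is infinite.\<close>

definition arc_nbhd :: "complex set \<Rightarrow> real \<Rightarrow> complex set" where
  "arc_nbhd E t = {\<zeta> \<in> circle. (INF w\<in>E. ennreal (arc_dist \<zeta> w)) \<le> ennreal t}"

text \<open>For \<open>t > 0\<close> the set counted is finite, because the complementary arcs are disjoint and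
  have total length at most $2\pi$.\<close>

definition gap_count :: "complex set \<Rightarrow> real \<Rightarrow> nat" where
  "gap_count E t = 2 * card {I \<in> components (circle - E). measure arc_length I > 2 * t}"

definition gauge_function :: "(real \<Rightarrow> real) \<Rightarrow> bool" where
  "gauge_function \<psi> \<longleftrightarrow> (\<forall>t\<in>{0<..<2*pi}. 0 < \<psi> t) \<and> mono_on {0<..<2*pi} \<psi> \<and> (\<psi> \<longlongrightarrow> 0) (at_right 0)"

definition admissible :: "real \<Rightarrow> (real \<Rightarrow> real) \<Rightarrow> bool" where
  "admissible \<alpha> \<psi> \<longleftrightarrow> \<alpha> > 0 \<and> gauge_function \<psi> \<and>
     (concave_on {0<..<2*pi} \<psi> \<or> convex_on {0<..<2*pi} \<psi>) \<and>
     antimono_on {0<..<2*pi} (\<lambda>s. \<psi> s / s powr \<alpha>)"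

text \<open>The integral, and hence the maximum, may be infinite; then its reciprocal in
  \<^typ>\<open>ennreal\<close> is \<open>0\<close>.\<close>

definition M_fun :: "(real \<Rightarrow> real) \<Rightarrow> complex set \<Rightarrow> real \<Rightarrow> ennreal" where
  "M_fun \<psi> E s =
     max (\<integral>\<^sup>+t\<in>{0<..<s}. ennreal (\<psi> t / t * real (gap_count E t)) \<partial>lborel)
         (ennreal (\<psi> s / s * measure arc_length (arc_nbhd E s)))"

end

theory Submission
  imports Defs "HOL-Complex_Analysis.Cauchy_Integral_Formula"
begin

text \<open>
  Let \<open>\<delta>(z)\<close> be the chordal distance to \<open>E\<close>, \<open>F(r)\<close> the length of \<open>{\<delta> < r}\<close>, and \<open>\<chi>\<^sub>j\<close> the
  piecewise linear function of \<open>\<delta>\<close> equal to \<open>1\<close> for \<open>\<delta> \<le> 2\<^sup>-\<^sup>j\<close> and to \<open>0\<close> for \<open>\<delta> \<ge> 2 \<cdot> 2\<^sup>-\<^sup>j\<close>. The test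
  function is \<open>u = \<Sum> c\<^sub>j \<chi>\<^sub>j / \<Sum> c\<^sub>j\<close>, the sums ranging over \<open>m \<le> j < n\<close>, where \<open>c\<^sub>j\<close> is comparable to the
  contribution of the scale \<open>2\<^sup>-\<^sup>j\<close> to the integral of \<open>s / (\<psi>(s) F(s))\<close>. The products
  \<open>\<bar>\<chi>\<^sub>j(z) - \<chi>\<^sub>j(\<xi>)\<bar> \<bar>\<chi>\<^sub>k(z) - \<chi>\<^sub>k(\<xi>)\<bar> / \<bar>z - \<xi>\<bar>\<^sup>2\<close> with \<open>k \<le> j\<close> vanish unless \<open>z\<close> or \<open>\<xi>\<close> lies within
  \<open>2 \<cdot> 2\<^sup>-\<^sup>j\<close> of \<open>E\<close>, and are bounded by a multiple of \<open>min(4\<^sup>k, \<bar>z - \<xi>\<bar>\<^sup>-\<^sup>2)\<close>. As \<open>\<psi>\<close> grows at most like a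
  power less than two, the integral of \<open>c\<^sub>j\<close> times this product decays geometrically in \<open>j - k\<close>.
  Hence the Dirichlet integral of \<open>u\<close> is at most a constant times \<open>1 / \<Sum> c\<^sub>j\<close>, which tends to \<open>0\<close> as
  \<open>n \<rightarrow> \<infinity>\<close>, while the \<open>L\<^sup>2\<close> norm is controlled by \<open>F(2 \<cdot> 2\<^sup>-\<^sup>m)\<close>. Only the lower bound
  \<open>\<psi>(s) \<bar>E\<^sub>s\<bar> / s\<close> for \<open>M(s)\<close> enters, so the complementary arcs are never counted.
\<close>

section \<open>Piecewise linear cutoffs and products of their increments\<close>

definition bump :: "real \<Rightarrow> real \<Rightarrow> real" where
  "bump a x = max 0 (min 1 (2 - x / a))"

lemma bump_nonneg [simp]: "0 \<le> bump a x"
  and bump_le_1 [simp]: "bump a x \<le> 1"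
  by (auto simp: bump_def)

lemma bump_eq_1: "0 < a \<Longrightarrow> x \<le> a \<Longrightarrow> bump a x = 1"
  by (simp add: bump_def)

lemma bump_eq_0: "0 < a \<Longrightarrow> 2 * a \<le> x \<Longrightarrow> bump a x = 0"
  by (simp add: bump_def field_simps)

lemma bump_diff_le_1: "\<bar>bump a x - bump a y\<bar> \<le> 1"
  by (auto simp: bump_def)

lemma bump_lipschitz:
  assumes "0 < a"
  shows "\<bar>bump a x - bump a y\<bar> \<le> \<bar>x - y\<bar> / a"
proof -
  have "\<bar>bump a x - bump a y\<bar> \<le> \<bar>x / a - y / a\<bar>"
    by (auto simp: bump_def)
  also have "\<dots> = \<bar>x - y\<bar> / a"
    using assms by (simp flip: diff_divide_distrib)
  finally show ?thesis .
qed

lemma bump_measurable [measurable]: "bump a \<in> borel_measurable borel"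
  unfolding bump_def by measurable

text \<open>The finer bump varies only close to the origin, where a much coarser one is constant. If both
  increments are nonzero and the scales are far apart, then \<open>r\<close> is at least half the coarser scale.\<close>

lemma bump_diff_prod_aux:
  assumes b: "0 < b" "b \<le> a" and r: "0 < r" "y - x \<le> r" and xy: "x \<le> y"
  shows "\<bar>bump b x - bump b y\<bar> * \<bar>bump a x - bump a y\<bar> / r\<^sup>2
    \<le> 4 * min (1 / a\<^sup>2) (1 / r\<^sup>2) * indicator {..<2 * b} x"
proof (cases "x < 2 * b \<and> a < y")
  case False
  \<comment> \<open>Either \<open>2 * b \<le> x\<close>, and the finer bump vanishes at both points,
    or \<open>y \<le> a\<close>, and the coarser one equals 1 at both.\<close>
  then have "bump b x - bump b y = 0 \<or> bump a x - bump a y = 0"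
    using b xy by (auto simp: bump_eq_0 bump_eq_1)
  then show ?thesis
    using b r by (auto simp: min_def split: split_indicator)
next
  case True
  let ?q = "\<bar>bump b x - bump b y\<bar> * \<bar>bump a x - bump a y\<bar>"
  have a: "0 < a" using b by simp
  have q1: "?q \<le> 1 * 1"
    by (intro mult_mono bump_diff_le_1) auto
  \<comment> \<open>For \<open>4 * b < a\<close> the right side is at least 1, since
    \<open>y - x\<close> exceeds \<open>a - 2 * b > a / 2\<close>. Otherwise the scales are
    comparable, and the Lipschitz constant \<open>1 / b\<close> is at most
    \<open>4 / a\<close>.\<close>
  have q2: "?q \<le> 4 * r\<^sup>2 / a\<^sup>2"
  proof (cases "4 * b < a")
    case True
    with \<open>x < 2 * b \<and> a < y\<close> r have "a \<le> 2 * r" by linarith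
    then have "a\<^sup>2 \<le> (2 * r)\<^sup>2" using a by (intro power_mono) auto
    then have "1 \<le> 4 * r\<^sup>2 / a\<^sup>2" using a by (simp add: field_simps)
    with q1 show ?thesis by simp
  next
    case False
    have "\<bar>bump b x - bump b y\<bar> \<le> r / b"
      using bump_lipschitz[of b x y] b r xy by (smt (verit) divide_right_mono)
    also have "\<dots> \<le> 4 * r / a"
      using False b a r by (simp add: field_simps)
    finally have *: "\<bar>bump b x - bump b y\<bar> \<le> 4 * r / a" .
    have **: "\<bar>bump a x - bump a y\<bar> \<le> r / a"
      using bump_lipschitz[of a x y] a r xy by (smt (verit) divide_right_mono)
    have "?q \<le> (4 * r / a) * (r / a)"
      using * ** a r by (intro mult_mono) auto
    then show ?thesis by (simp add: power2_eq_square)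
  qed
  have "?q / r\<^sup>2 \<le> 4 * (1 / a\<^sup>2)" "?q / r\<^sup>2 \<le> 4 * (1 / r\<^sup>2)"
    using q1 q2 a r by (simp_all add: field_simps)
  then show ?thesis using True by (simp add: min_def)
qed

lemma bump_diff_prod:
  assumes "0 < b" "b \<le> a" "0 < r" "\<bar>x - y\<bar> \<le> r"
  shows "\<bar>bump b x - bump b y\<bar> * \<bar>bump a x - bump a y\<bar> / r\<^sup>2
    \<le> 4 * min (1 / a\<^sup>2) (1 / r\<^sup>2) * (indicator {..<2 * b} x + indicator {..<2 * b} y)"
proof -
  have nn: "0 \<le> 4 * min (1 / a\<^sup>2) (1 / r\<^sup>2)" by simp
  show ?thesis
  proof (cases "x \<le> y")
    case True
    from bump_diff_prod_aux[of b a r y x] assms True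
    have "\<bar>bump b x - bump b y\<bar> * \<bar>bump a x - bump a y\<bar> / r\<^sup>2
      \<le> 4 * min (1 / a\<^sup>2) (1 / r\<^sup>2) * indicator {..<2 * b} x" by simp
    also have "\<dots> \<le> 4 * min (1 / a\<^sup>2) (1 / r\<^sup>2) * (indicator {..<2 * b} x + indicator {..<2 * b} y)"
      by (intro mult_left_mono nn) auto
    finally show ?thesis .
  next
    case False
    from bump_diff_prod_aux[of b a r x y] assms False
    have "\<bar>bump b x - bump b y\<bar> * \<bar>bump a x - bump a y\<bar> / r\<^sup>2
      \<le> 4 * min (1 / a\<^sup>2) (1 / r\<^sup>2) * indicator {..<2 * b} y"
      by (simp add: abs_minus_commute)
    also have "\<dots> \<le> 4 * min (1 / a\<^sup>2) (1 / r\<^sup>2) * (indicator {..<2 * b} x + indicator {..<2 * b} y)"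
      by (intro mult_left_mono nn) auto
    finally show ?thesis .
  qed
qed

section \<open>A dyadic majorant of the truncated inverse square\<close>

text \<open>A layered version of \<open>min (1 / a\<^sup>2) (1 / r\<^sup>2)\<close>. Being a sum of
  indicators of intervals, it integrates to a weighted sum of ball masses.\<close>

definition kern :: "real \<Rightarrow> real \<Rightarrow> ennreal" where
  "kern a r = (\<Sum>i. ennreal (4 / (4 ^ i * a\<^sup>2)) * indicator {..<2 ^ i * a} r)"

lemma kern_measurable [measurable]: "kern a \<in> borel_measurable borel"
  unfolding kern_def by measurable

text \<open>One layer suffices: the least \<open>i\<close> with \<open>r < 2 ^ i * a\<close>. If
  \<open>i = Suc k\<close>, minimality gives \<open>2 ^ k * a \<le> r\<close>, and the factor 4 in
  \<open>kern\<close> makes up for the step from \<open>k\<close> to \<open>i\<close>.\<close>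

lemma kern_ge:
  assumes a: "0 < a" and r: "0 < r"
  shows "ennreal (min (1 / a\<^sup>2) (1 / r\<^sup>2)) \<le> kern a r"
proof -
  have "\<exists>i. r < 2 ^ i * a \<and> min (1 / a\<^sup>2) (1 / r\<^sup>2) \<le> 4 / (4 ^ i * a\<^sup>2)"
  proof (cases "r < a")
    case True
    then show ?thesis using a by (intro exI[of _ 0]) (auto simp: min_def field_simps)
  next
    case False
    have "\<exists>i. r < 2 ^ i * a"
      using real_arch_pow[of 2 "r / a"] a by (auto simp: field_simps)
    then have ex: "\<exists>i. r < 2 ^ i * a" .
    define i where "i = (LEAST i. r < 2 ^ i * a)"
    have i: "r < 2 ^ i * a" unfolding i_def using ex by (rule LeastI_ex)
    with False have "i \<noteq> 0" by (intro notI) simp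
    then obtain k where k: "i = Suc k" by (cases i) auto
    have "\<not> r < 2 ^ k * a"
      using not_less_Least[of k "\<lambda>i. r < 2 ^ i * a"] k unfolding i_def by simp
    then have "(2 ^ k * a)\<^sup>2 \<le> r\<^sup>2" using a by (intro power_mono) auto
    moreover have "((2::real) ^ k)\<^sup>2 = 4 ^ k"
      by (simp add: power2_eq_square flip: power_mult_distrib)
    ultimately have "4 ^ k * a\<^sup>2 \<le> r\<^sup>2"
      by (simp add: power_mult_distrib)
    then have "1 / r\<^sup>2 \<le> 1 / (4 ^ k * a\<^sup>2)" using a r by (intro divide_left_mono) (auto intro!: mult_pos_pos)
    also have "\<dots> = 4 / (4 ^ i * a\<^sup>2)" using k by simp
    finally have "min (1 / a\<^sup>2) (1 / r\<^sup>2) \<le> 4 / (4 ^ i * a\<^sup>2)" by (rule min.coboundedI2)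
    with i show ?thesis by blast
  qed
  then obtain i where i: "r < 2 ^ i * a" "min (1 / a\<^sup>2) (1 / r\<^sup>2) \<le> 4 / (4 ^ i * a\<^sup>2)" by blast
  have "ennreal (min (1 / a\<^sup>2) (1 / r\<^sup>2)) \<le> ennreal (4 / (4 ^ i * a\<^sup>2)) * indicator {..<2 ^ i * a} r"
    using i by (simp add: ennreal_leI)
  also have "\<dots> = (\<Sum>j\<in>{i}. ennreal (4 / (4 ^ j * a\<^sup>2)) * indicator {..<2 ^ j * a} r)" by (subst sum.insert) (simp_all only: finite.emptyI empty_iff not_False_eq_True sum.empty add_0_right)
  also have "\<dots> \<le> kern a r"
    unfolding kern_def by (intro sum_le_suminf) auto
  finally show ?thesis .
qed

text \<open>Layer \<open>i\<close> contributes at most a multiple of \<open>(D / 4) ^ i\<close>.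
  This is where growth of ball masses below the square of the radius is used.\<close>

lemma nn_integral_kern_le:
  fixes M :: "'a :: {metric_space, second_countable_topology} measure"
  assumes [measurable]: "(\<lambda>x. x) \<in> borel_measurable M"
    and a: "0 < a" and B: "0 \<le> B" and D: "0 < D" "D < 4"
    and ball: "\<And>i. emeasure M {x \<in> space M. dist x z < 2 ^ i * a} \<le> ennreal (B * D ^ i)"
  shows "(\<integral>\<^sup>+x. kern a (dist x z) \<partial>M) \<le> ennreal (16 * B / (a\<^sup>2 * (4 - D)))"
proof -
  have "(\<integral>\<^sup>+x. kern a (dist x z) \<partial>M)
      = (\<Sum>i. \<integral>\<^sup>+x. ennreal (4 / (4 ^ i * a\<^sup>2)) * indicator {..<2 ^ i * a} (dist x z) \<partial>M)"
    unfolding kern_def by (intro nn_integral_suminf) measurable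
  also have "\<dots> = (\<Sum>i. ennreal (4 / (4 ^ i * a\<^sup>2)) * emeasure M {x \<in> space M. dist x z < 2 ^ i * a})"
  proof (intro suminf_cong)
    fix i
    have "(\<integral>\<^sup>+x. ennreal (4 / (4 ^ i * a\<^sup>2)) * indicator {..<2 ^ i * a} (dist x z) \<partial>M)
      = (\<integral>\<^sup>+x. ennreal (4 / (4 ^ i * a\<^sup>2)) * indicator {x \<in> space M. dist x z < 2 ^ i * a} x \<partial>M)"
      by (intro nn_integral_cong) (auto split: split_indicator)
    then show "(\<integral>\<^sup>+x. ennreal (4 / (4 ^ i * a\<^sup>2)) * indicator {..<2 ^ i * a} (dist x z) \<partial>M)
      = ennreal (4 / (4 ^ i * a\<^sup>2)) * emeasure M {x \<in> space M. dist x z < 2 ^ i * a}"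
      by (simp add: nn_integral_cmult_indicator)
  qed
  also have "\<dots> \<le> (\<Sum>i. ennreal (4 * B / a\<^sup>2 * (D / 4) ^ i))"
  proof (intro suminf_le summableI)
    fix i
    have "ennreal (4 / (4 ^ i * a\<^sup>2)) * emeasure M {x \<in> space M. dist x z < 2 ^ i * a}
      \<le> ennreal (4 / (4 ^ i * a\<^sup>2)) * ennreal (B * D ^ i)"
      by (intro mult_left_mono ball) auto
    also have "\<dots> = ennreal (4 * B / a\<^sup>2 * (D / 4) ^ i)"
      using a B D by (simp add: ennreal_mult' [symmetric] power_divide field_simps)
    finally show "ennreal (4 / (4 ^ i * a\<^sup>2)) * emeasure M {x \<in> space M. dist x z < 2 ^ i * a}
      \<le> ennreal (4 * B / a\<^sup>2 * (D / 4) ^ i)" .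
  qed
  also have "\<dots> = ennreal (4 * B / a\<^sup>2 * (1 / (1 - D / 4)))"
    using a B D by (intro suminf_ennreal_eq sums_mult geometric_sums) auto
  also have "4 * B / a\<^sup>2 * (1 / (1 - D / 4)) = 16 * B / (a\<^sup>2 * (4 - D))"
    using D a by (simp add: field_simps)
  finally show ?thesis .
qed

section \<open>Double sums over scales\<close>

text \<open>Ordering the pairs lets the larger index always denote the finer scale. Doubling the
  ordered sum covers both orders and counts the diagonal twice.\<close>

lemma sum_square_le:
  fixes x :: "nat \<Rightarrow> real"
  assumes "finite I"
  shows "(\<Sum>j\<in>I. x j)\<^sup>2 \<le> 2 * (\<Sum>k\<in>I. \<Sum>j\<in>I. if k \<le> j then \<bar>x j\<bar> * \<bar>x k\<bar> else 0)"
proof -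
  let ?g = "\<lambda>k j. if k \<le> j then \<bar>x j\<bar> * \<bar>x k\<bar> else 0"
  have "(\<Sum>j\<in>I. x j)\<^sup>2 = (\<Sum>k\<in>I. \<Sum>j\<in>I. x k * x j)"
    by (simp add: power2_eq_square sum_product)
  also have "\<dots> \<le> (\<Sum>k\<in>I. \<Sum>j\<in>I. ?g k j + ?g j k)"
  proof (intro sum_mono)
    fix k j
    have "x k * x j \<le> \<bar>x j\<bar> * \<bar>x k\<bar>" by (simp flip: abs_mult) (simp add: mult.commute)
    then show "x k * x j \<le> ?g k j + ?g j k" by (auto simp: mult.commute)
  qed
  also have "\<dots> = (\<Sum>k\<in>I. \<Sum>j\<in>I. ?g k j) + (\<Sum>k\<in>I. \<Sum>j\<in>I. ?g j k)"
    by (simp add: sum.distrib)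
  also have "(\<Sum>k\<in>I. \<Sum>j\<in>I. ?g j k) = (\<Sum>k\<in>I. \<Sum>j\<in>I. ?g k j)"
    by (rule sum.swap)
  finally show ?thesis by simp
qed

lemma geometric_tail_le:
  fixes q :: real
  assumes "0 \<le> q" "q < 1" "finite I"
  shows "(\<Sum>j\<in>I. if k \<le> j then q ^ (j - k) else 0) \<le> 1 / (1 - q)"
proof -
  have "(\<Sum>j\<in>I. if k \<le> j then q ^ (j - k) else 0) = (\<Sum>j\<in>{j\<in>I. k \<le> j}. q ^ (j - k))"
    using assms by (simp add: sum.inter_filter)
  also have "\<dots> = (\<Sum>i\<in>(\<lambda>j. j - k) ` {j\<in>I. k \<le> j}. q ^ i)"
    by (subst sum.reindex) (auto simp: inj_on_def)
  also have "\<dots> \<le> (\<Sum>i. q ^ i)"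
    using assms by (intro sum_le_suminf summable_geometric) auto
  also have "\<dots> = 1 / (1 - q)" using assms by (intro suminf_geometric) auto
  finally show ?thesis .
qed

subsection \<open>Energy of superpositions of bumps\<close>

text \<open>\<mu> carries the Dirichlet integral and \<nu> is a one-dimensional reference measure.
  The condition \<open>D < 4\<close> bounds the growth of \<phi> by a power less than two, and
  \<open>2 \<le> D\<close> lets \<open>D / 4\<close> dominate the ratio 1/2 of successive
  scales.\<close>

locale thin_set =
  fixes \<mu> \<nu> :: "'a :: {metric_space, second_countable_topology} measure"
    and E :: "'a set" and \<phi> :: "real \<Rightarrow> real" and C D :: real
  assumes finite_mu: "finite_measure \<mu>" and finite_nu: "finite_measure \<nu>"
    and measurable_mu [measurable]: "(\<lambda>x. x) \<in> borel_measurable \<mu>"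
    and measurable_nu [measurable]: "(\<lambda>x. x) \<in> borel_measurable \<nu>"
    and space_eq: "space \<nu> = space \<mu>"
    and E_subset: "E \<subseteq> space \<mu>" and E_nonempty: "E \<noteq> {}"
    and phi_pos: "\<And>r. 0 < r \<Longrightarrow> 0 < \<phi> r"
    and phi_mono: "\<And>r s. 0 < r \<Longrightarrow> r \<le> s \<Longrightarrow> \<phi> r \<le> \<phi> s"
    and phi_double: "\<And>r. 0 < r \<Longrightarrow> \<phi> (2 * r) \<le> D * \<phi> r"
    and C_pos: "0 < C" and D_ge: "2 \<le> D" and D_less: "D < 4"
    and mu_ball: "\<And>e r. e \<in> E \<Longrightarrow> 0 < r \<Longrightarrow>
      emeasure \<mu> {x \<in> space \<mu>. dist x e < r} \<le> ennreal (\<phi> r)"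
    and nu_ball_le: "\<And>x r. x \<in> space \<mu> \<Longrightarrow> 0 < r \<Longrightarrow>
      emeasure \<nu> {z \<in> space \<nu>. dist z x < r} \<le> ennreal (C * r)"
    and nu_ball_ge: "\<And>x r. x \<in> space \<mu> \<Longrightarrow> 0 < r \<Longrightarrow> r \<le> 1 \<Longrightarrow>
      ennreal r \<le> emeasure \<nu> {z \<in> space \<nu>. dist z x < r}"
begin

interpretation mu: finite_measure \<mu> by (rule finite_mu)
interpretation nu: finite_measure \<nu> by (rule finite_nu)
interpretation P: pair_sigma_finite \<mu> \<nu> ..

abbreviation del :: "'a \<Rightarrow> real" where
  "del z \<equiv> infdist z E"

definition F :: "real \<Rightarrow> real" where
  "F r = measure \<nu> {z \<in> space \<nu>. del z < r}"

lemma del_measurable [measurable]: "del \<in> borel_measurable borel"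
  by (intro borel_measurable_continuous_onI continuous_intros)

lemma F_mono: "r \<le> s \<Longrightarrow> F r \<le> F s"
  unfolding F_def by (intro nu.finite_measure_mono) auto

lemma emeasure_F: "emeasure \<nu> {z \<in> space \<nu>. del z < r} = ennreal (F r)"
  unfolding F_def by (rule nu.emeasure_eq_measure)

lemma F_pos:
  assumes "0 < r"
  shows "0 < F r"
proof -
  obtain e where e: "e \<in> E" using E_nonempty by auto
  have "ennreal (min r 1) \<le> emeasure \<nu> {z \<in> space \<nu>. dist z e < min r 1}"
    using e E_subset assms by (intro nu_ball_ge) auto
  also have "\<dots> \<le> emeasure \<nu> {z \<in> space \<nu>. del z < r}"
    using infdist_le[OF e] by (intro emeasure_mono) (auto intro: le_less_trans)
  finally have "min r 1 \<le> F r"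
    unfolding emeasure_F by (subst (asm) ennreal_le_iff) (auto simp: F_def)
  with assms show ?thesis by linarith
qed

lemma phi_pow: "0 < r \<Longrightarrow> \<phi> (2 ^ i * r) \<le> D ^ i * \<phi> r"
proof (induction i)
  case (Suc i)
  have "\<phi> (2 * (2 ^ i * r)) \<le> D * \<phi> (2 ^ i * r)"
    using Suc.prems by (intro phi_double) auto
  also have "\<dots> \<le> D * (D ^ i * \<phi> r)"
    using Suc D_ge by (intro mult_left_mono) auto
  finally show ?case by (simp add: mult.assoc)
qed simp

text \<open>The hypothesis on \<mu> concerns centres in \<open>E\<close> only; other centres are
  moved to a point of \<open>E\<close> at the price of a larger radius.\<close>

lemma mu_ball_near:
  assumes "del z < s" "0 < r" "0 < s"
  shows "emeasure \<mu> {x \<in> space \<mu>. dist x z < r} \<le> ennreal (\<phi> (r + s))"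
proof -
  obtain e where e: "e \<in> E" "dist z e < s"
    using assms(1) E_nonempty by (auto simp: infdist_def cINF_less_iff)
  have "emeasure \<mu> {x \<in> space \<mu>. dist x z < r} \<le> emeasure \<mu> {x \<in> space \<mu>. dist x e < r + s}"
  proof (intro emeasure_mono)
    show "{x \<in> space \<mu>. dist x z < r} \<subseteq> {x \<in> space \<mu>. dist x e < r + s}"
    proof clarify
      fix x assume "dist x z < r"
      then show "dist x e < r + s"
        using dist_triangle[of x e z] e by linarith
    qed
  qed measurable
  also have "\<dots> \<le> ennreal (\<phi> (r + s))"
    using e assms by (intro mu_ball) auto
  finally show ?thesis .
qed

text \<open>Integrate \<open>\<mu>\<close>-measures of small balls over a neighbourhood of \<open>E\<close>; this replaces a covering argument.\<close>

lemma mu_nbhd: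
  assumes "0 < a" "a \<le> 1"
  shows "emeasure \<mu> {x \<in> space \<mu>. del x < a} \<le> ennreal (\<phi> (4 * a) * F (2 * a) / a)"
proof -
  let ?W = "{x \<in> space \<mu>. del x < a}"
  have "ennreal a * emeasure \<mu> ?W = (\<integral>\<^sup>+x. ennreal a * indicator ?W x \<partial>\<mu>)"
    by (simp add: nn_integral_cmult_indicator)
  also have "\<dots> \<le> (\<integral>\<^sup>+x. \<integral>\<^sup>+z. indicator {..<a} (dist z x) * indicator {..<2 * a} (del z) \<partial>\<nu> \<partial>\<mu>)"
  proof (intro nn_integral_mono)
    fix x assume x: "x \<in> space \<mu>"
    show "ennreal a * indicator ?W x
      \<le> (\<integral>\<^sup>+z. indicator {..<a} (dist z x) * indicator {..<2 * a} (del z) \<partial>\<nu>)"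
    proof (cases "del x < a")
      case True
      have "ennreal a \<le> emeasure \<nu> {z \<in> space \<nu>. dist z x < a}"
        using assms x by (intro nu_ball_ge) auto
      also have "\<dots> = (\<integral>\<^sup>+z. indicator {z \<in> space \<nu>. dist z x < a} z \<partial>\<nu>)"
        by simp
      also have "\<dots> \<le> (\<integral>\<^sup>+z. indicator {..<a} (dist z x) * indicator {..<2 * a} (del z) \<partial>\<nu>)"
      proof (intro nn_integral_mono)
        fix z
        have "del z \<le> del x + dist z x" by (rule infdist_triangle)
        then show "indicator {z \<in> space \<nu>. dist z x < a} z
          \<le> (indicator {..<a} (dist z x) * indicator {..<2 * a} (del z) :: ennreal)"
          using True by (auto split: split_indicator)
      qed
      finally show ?thesis using True x by simp
    qed (use x in simp)
  qed
  also have "\<dots> = (\<integral>\<^sup>+z. \<integral>\<^sup>+x. indicator {..<a} (dist z x) * indicator {..<2 * a} (del z) \<partial>\<mu> \<partial>\<nu>)"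
    by (intro P.Fubini'[symmetric]) measurable
  also have "\<dots> \<le> (\<integral>\<^sup>+z. ennreal (\<phi> (4 * a)) * indicator {z \<in> space \<nu>. del z < 2 * a} z \<partial>\<nu>)"
  proof (intro nn_integral_mono)
    fix z assume z: "z \<in> space \<nu>"
    show "(\<integral>\<^sup>+x. indicator {..<a} (dist z x) * indicator {..<2 * a} (del z) \<partial>\<mu>)
      \<le> ennreal (\<phi> (4 * a)) * indicator {z \<in> space \<nu>. del z < 2 * a} z"
    proof (cases "del z < 2 * a")
      case True
      have "(\<integral>\<^sup>+x. indicator {..<a} (dist z x) * indicator {..<2 * a} (del z) \<partial>\<mu>)
        = (\<integral>\<^sup>+x. indicator {x \<in> space \<mu>. dist x z < a} x \<partial>\<mu>)"
        using True by (intro nn_integral_cong) (auto simp: dist_commute split: split_indicator)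
      also have "\<dots> = emeasure \<mu> {x \<in> space \<mu>. dist x z < a}" by simp
      also have "\<dots> \<le> ennreal (\<phi> (a + 2 * a))"
        using True assms by (intro mu_ball_near) auto
      \<comment> \<open>The radius \<open>3 * a\<close> is rounded up to a power of two times
        \<open>a\<close>, ready for doubling.\<close>
      also have "\<dots> \<le> ennreal (\<phi> (4 * a))"
        using assms by (intro ennreal_leI phi_mono) auto
      finally show ?thesis using True z by simp
    qed simp
  qed
  also have "\<dots> = ennreal (\<phi> (4 * a)) * ennreal (F (2 * a))"
    by (simp add: nn_integral_cmult_indicator emeasure_F)
  finally have "ennreal a * emeasure \<mu> ?W \<le> ennreal (\<phi> (4 * a)) * ennreal (F (2 * a))" .
  then have "a * measure \<mu> ?W \<le> \<phi> (4 * a) * F (2 * a)"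
    using assms phi_pos[of "4 * a"] F_pos[of "2 * a"]
    by (simp add: mu.emeasure_eq_measure flip: ennreal_mult')
  then show ?thesis
    using assms by (simp add: mu.emeasure_eq_measure field_simps ennreal_leI)
qed

text \<open>The two summands are the constants for the two cases of the energy estimate: the
  \<mu>-variable near \<open>E\<close>, and the \<nu>-variable near \<open>E\<close>.\<close>

definition A :: real where
  "A = 16 * C * D ^ 3 + 64 * D\<^sup>2 / (4 - D)"

lemma A_pos: "0 < A"
  unfolding A_def using C_pos D_ge D_less by (intro add_pos_pos) auto

text \<open>By \<open>bump_diff_prod\<close> and \<open>kern_ge\<close> the integrand is bounded by
  \<open>kern a\<close>, restricted to \<open>x\<close> or \<open>z\<close> within
  \<open>2 * b\<close> of \<open>E\<close>. In each case the kernel is integrated first over the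
  unrestricted variable, and then the measure of the neighbourhood enters.\<close>

lemma energy_pair:
  assumes b: "0 < b" "b \<le> a" "2 * b \<le> 1"
  shows "(\<integral>\<^sup>+x. \<integral>\<^sup>+z. ennreal (\<bar>bump b (del z) - bump b (del x)\<bar> * \<bar>bump a (del z) - bump a (del x)\<bar>
      / (dist z x)\<^sup>2) \<partial>\<nu> \<partial>\<mu>)
    \<le> ennreal (A * F (4 * b) * (\<phi> b / (a * b) + \<phi> a / a\<^sup>2))"
    (is "?L \<le> _")
proof -
  have a: "0 < a" using b by simp
  have near: "indicator {..<2 * b} (del z) = (indicator {z \<in> space \<nu>. del z < 2 * b} z :: ennreal)"
    if "z \<in> space \<nu>" for z using that by (auto split: split_indicator)
  have "?L \<le> (\<integral>\<^sup>+x. \<integral>\<^sup>+z. (4 * indicator {..<2 * b} (del x)) * kern a (dist z x)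
      + (4 * indicator {..<2 * b} (del z)) * kern a (dist z x) \<partial>\<nu> \<partial>\<mu>)"
  proof (intro nn_integral_mono)
    fix x z
    show "ennreal (\<bar>bump b (del z) - bump b (del x)\<bar> * \<bar>bump a (del z) - bump a (del x)\<bar> / (dist z x)\<^sup>2)
      \<le> (4 * indicator {..<2 * b} (del x)) * kern a (dist z x)
        + (4 * indicator {..<2 * b} (del z)) * kern a (dist z x)"
    \<comment> \<open>On the diagonal both increments vanish, so the left side is 0.\<close>
    proof (cases "z = x")
      case False
      let ?r = "dist z x" and ?m = "min (1 / a\<^sup>2) (1 / (dist z x)\<^sup>2)"
        and ?i = "indicator {..<2 * b} (del z) + indicator {..<2 * b} (del x) :: real"
      have r: "0 < ?r" using False by simp
      have "ennreal (\<bar>bump b (del z) - bump b (del x)\<bar> * \<bar>bump a (del z) - bump a (del x)\<bar> / ?r\<^sup>2)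
        \<le> ennreal (4 * ?m * ?i)"
        using b r infdist_triangle_abs[of z E x] by (intro ennreal_leI bump_diff_prod) auto
      also have "\<dots> = 4 * ennreal ?m * (indicator {..<2 * b} (del z) + indicator {..<2 * b} (del x))"
        by (simp add: ennreal_mult'' ennreal_indicator split: split_indicator)
      also have "\<dots> \<le> 4 * kern a ?r * (indicator {..<2 * b} (del z) + indicator {..<2 * b} (del x))"
        using kern_ge[OF a r] by (intro mult_right_mono mult_left_mono) auto
      finally show ?thesis by (simp add: algebra_simps)
    qed simp
  qed
  also have "\<dots> = (\<integral>\<^sup>+x. \<integral>\<^sup>+z. (4 * indicator {..<2 * b} (del x)) * kern a (dist z x) \<partial>\<nu> \<partial>\<mu>)
      + (\<integral>\<^sup>+x. \<integral>\<^sup>+z. (4 * indicator {..<2 * b} (del z)) * kern a (dist z x) \<partial>\<nu> \<partial>\<mu>)"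
    by (subst nn_integral_add[symmetric]) (auto intro!: nn_integral_cong nn_integral_add)
  also have "(\<integral>\<^sup>+x. \<integral>\<^sup>+z. (4 * indicator {..<2 * b} (del z)) * kern a (dist z x) \<partial>\<nu> \<partial>\<mu>)
      = (\<integral>\<^sup>+z. \<integral>\<^sup>+x. (4 * indicator {..<2 * b} (del z)) * kern a (dist z x) \<partial>\<mu> \<partial>\<nu>)"
    by (intro P.Fubini'[symmetric]) measurable
  \<comment> \<open>Since \<nu> is one-dimensional, the kernel has \<nu>-integral at most
    \<open>8 * C / a\<close>. Then \<open>mu_nbhd\<close> at radius \<open>2 * b\<close> produces
    \<open>\<phi> (8 * b)\<close>, whence the factor \<open>D ^ 3\<close>.\<close>
  also have "(\<integral>\<^sup>+x. \<integral>\<^sup>+z. (4 * indicator {..<2 * b} (del x)) * kern a (dist z x) \<partial>\<nu> \<partial>\<mu>)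
      \<le> ennreal (16 * C * D ^ 3 * F (4 * b) * (\<phi> b / (a * b)))"
  proof -
    have "(\<integral>\<^sup>+z. kern a (dist z x) \<partial>\<nu>) \<le> ennreal (8 * C / a)" if x: "x \<in> space \<mu>" for x
    proof -
      have "(\<integral>\<^sup>+z. kern a (dist z x) \<partial>\<nu>) \<le> ennreal (16 * (C * a) / (a\<^sup>2 * (4 - 2)))"
      proof (intro nn_integral_kern_le a)
        fix i
        show "emeasure \<nu> {z \<in> space \<nu>. dist z x < 2 ^ i * a} \<le> ennreal (C * a * 2 ^ i)"
          using nu_ball_le[OF x, of "2 ^ i * a"] a by (simp add: ac_simps)
      qed (use a C_pos in auto)
      also have "16 * (C * a) / (a\<^sup>2 * (4 - 2)) = 8 * C / a"
        using a by (simp add: field_simps power2_eq_square)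
      finally show ?thesis .
    qed
    then have "(\<integral>\<^sup>+x. \<integral>\<^sup>+z. (4 * indicator {..<2 * b} (del x)) * kern a (dist z x) \<partial>\<nu> \<partial>\<mu>)
      \<le> (\<integral>\<^sup>+x. (4 * indicator {..<2 * b} (del x)) * ennreal (8 * C / a) \<partial>\<mu>)"
      by (intro nn_integral_mono) (auto simp: nn_integral_cmult intro!: mult_left_mono)
    also have "\<dots> = (\<integral>\<^sup>+x. ennreal (32 * C / a) * indicator {x \<in> space \<mu>. del x < 2 * b} x \<partial>\<mu>)"
      using a C_pos by (intro nn_integral_cong)
        (auto simp: ennreal_mult'[symmetric] simp flip: ennreal_numeral split: split_indicator)
    also have "\<dots> = ennreal (32 * C / a) * emeasure \<mu> {x \<in> space \<mu>. del x < 2 * b}"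
      by (simp add: nn_integral_cmult_indicator)
    also have "\<dots> \<le> ennreal (32 * C / a) * ennreal (\<phi> (4 * (2 * b)) * F (2 * (2 * b)) / (2 * b))"
      using b by (intro mult_left_mono mu_nbhd) auto
    also have "\<dots> = ennreal (32 * C / a * (\<phi> (4 * (2 * b)) * F (2 * (2 * b)) / (2 * b)))"
      using a C_pos by (intro ennreal_mult'[symmetric]) auto
    also have "\<dots> \<le> ennreal (32 * C / a * ((D ^ 3 * \<phi> b) * F (4 * b) / (2 * b)))"
    proof -
      have "\<phi> (4 * (2 * b)) \<le> D ^ 3 * \<phi> b"
        using phi_pow[of b 3] b by simp
      then show ?thesis
        using a b C_pos D_ge F_pos[of "4 * b"] phi_pos[of b]
        by (intro ennreal_leI mult_left_mono divide_right_mono mult_mono) auto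
    qed
    also have "32 * C / a * ((D ^ 3 * \<phi> b) * F (4 * b) / (2 * b))
      = 16 * C * D ^ 3 * F (4 * b) * (\<phi> b / (a * b))"
      using a b by (simp add: field_simps)
    finally show ?thesis .
  qed
  \<comment> \<open>Here \<open>z\<close> lies within \<open>2 * b \<le> 2 * a\<close> of
    \<open>E\<close>, so its ball of radius \<open>2 ^ i * a\<close> has mass at most
    \<open>\<phi> (2 ^ i * (4 * a))\<close>. Doubling turns this into
    \<open>D ^ i * (D\<^sup>2 * \<phi> a)\<close>.\<close>
  also have "(\<integral>\<^sup>+z. \<integral>\<^sup>+x. (4 * indicator {..<2 * b} (del z)) * kern a (dist z x) \<partial>\<mu> \<partial>\<nu>)
      \<le> ennreal (64 * D\<^sup>2 / (4 - D) * F (4 * b) * (\<phi> a / a\<^sup>2))"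
  proof -
    let ?K = "16 * (D\<^sup>2 * \<phi> a) / (a\<^sup>2 * (4 - D))"
    have K: "0 \<le> ?K" using phi_pos[OF a] D_less by auto
    have kern: "(\<integral>\<^sup>+x. kern a (dist x z) \<partial>\<mu>) \<le> ennreal ?K" if z: "del z < 2 * a" for z
    proof (intro nn_integral_kern_le a)
      fix i
      have "emeasure \<mu> {x \<in> space \<mu>. dist x z < 2 ^ i * a} \<le> ennreal (\<phi> (2 ^ i * a + 2 * a))"
        using z a by (intro mu_ball_near) auto
      also have "\<phi> (2 ^ i * a + 2 * a) \<le> \<phi> (2 ^ i * (4 * a))"
      proof (intro phi_mono)
        have "1 * a \<le> 2 ^ i * a" using a by (intro mult_right_mono) auto
        moreover have "2 ^ i * (4 * a) = 4 * (2 ^ i * a)" by simp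
        ultimately show "2 ^ i * a + 2 * a \<le> 2 ^ i * (4 * a)" using a by linarith
      qed (use a in \<open>auto intro: add_pos_pos\<close>)
      also have "\<dots> \<le> D ^ i * \<phi> (4 * a)" using a by (intro phi_pow) auto
      also have "\<dots> \<le> D ^ i * (D\<^sup>2 * \<phi> a)"
        using phi_pow[of a 2] a D_ge by (intro mult_left_mono) auto
      finally show "emeasure \<mu> {x \<in> space \<mu>. dist x z < 2 ^ i * a} \<le> ennreal (D\<^sup>2 * \<phi> a * D ^ i)"
        by (simp add: ac_simps ennreal_leI)
    qed (use D_ge D_less phi_pos[OF a] in auto)
    have "(\<integral>\<^sup>+z. \<integral>\<^sup>+x. (4 * indicator {..<2 * b} (del z)) * kern a (dist z x) \<partial>\<mu> \<partial>\<nu>)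
      \<le> (\<integral>\<^sup>+z. ennreal (4 * ?K) * indicator {z \<in> space \<nu>. del z < 2 * b} z \<partial>\<nu>)"
    proof (intro nn_integral_mono)
      fix z assume z: "z \<in> space \<nu>"
      show "(\<integral>\<^sup>+x. (4 * indicator {..<2 * b} (del z)) * kern a (dist z x) \<partial>\<mu>)
        \<le> ennreal (4 * ?K) * indicator {z \<in> space \<nu>. del z < 2 * b} z"
      proof (cases "del z < 2 * b")
        case True
        then have "4 * (\<integral>\<^sup>+x. kern a (dist x z) \<partial>\<mu>) \<le> 4 * ennreal ?K"
          using b by (intro mult_left_mono kern) auto
        also have "\<dots> = ennreal (4 * ?K)"
          using K by (subst ennreal_mult') auto
        finally show ?thesis
          using True z by (simp add: nn_integral_cmult dist_commute)
      qed simp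
    qed
    also have "\<dots> = ennreal (4 * ?K) * ennreal (F (2 * b))"
      by (simp add: nn_integral_cmult_indicator emeasure_F)
    also have "\<dots> = ennreal (4 * ?K * F (2 * b))"
      using K by (intro ennreal_mult'[symmetric]) auto
    also have "\<dots> \<le> ennreal (4 * ?K * F (4 * b))"
      using K b by (intro ennreal_leI mult_left_mono F_mono) auto
    also have "4 * ?K * F (4 * b) = 64 * D\<^sup>2 / (4 - D) * F (4 * b) * (\<phi> a / a\<^sup>2)"
      by (simp add: ac_simps)
    finally show ?thesis .
  qed
  also have "ennreal (16 * C * D ^ 3 * F (4 * b) * (\<phi> b / (a * b)))
      + ennreal (64 * D\<^sup>2 / (4 - D) * F (4 * b) * (\<phi> a / a\<^sup>2))
    = ennreal (16 * C * D ^ 3 * F (4 * b) * (\<phi> b / (a * b))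
      + 64 * D\<^sup>2 / (4 - D) * F (4 * b) * (\<phi> a / a\<^sup>2))"
    using a b C_pos D_ge D_less phi_pos[OF a] phi_pos[of b] F_pos[of "4 * b"]
    by (intro ennreal_plus[symmetric]) auto
  also have "\<dots> \<le> ennreal (A * F (4 * b) * (\<phi> b / (a * b) + \<phi> a / a\<^sup>2))"
  proof (intro ennreal_leI)
    have p: "0 \<le> F (4 * b) * (\<phi> b / (a * b))" "0 \<le> F (4 * b) * (\<phi> a / a\<^sup>2)"
      using a b phi_pos[OF a] phi_pos[of b] F_pos[of "4 * b"] by auto
    have "16 * C * D ^ 3 * (F (4 * b) * (\<phi> b / (a * b))) \<le> A * (F (4 * b) * (\<phi> b / (a * b)))"
      using D_less by (intro mult_right_mono p) (auto simp: A_def)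
    moreover have "64 * D\<^sup>2 / (4 - D) * (F (4 * b) * (\<phi> a / a\<^sup>2)) \<le> A * (F (4 * b) * (\<phi> a / a\<^sup>2))"
      using C_pos D_ge by (intro mult_right_mono p) (auto simp: A_def)
    ultimately show "16 * C * D ^ 3 * F (4 * b) * (\<phi> b / (a * b))
      + 64 * D\<^sup>2 / (4 - D) * F (4 * b) * (\<phi> a / a\<^sup>2)
      \<le> A * F (4 * b) * (\<phi> b / (a * b) + \<phi> a / a\<^sup>2)"
      by (simp only: distrib_left mult.assoc)
  qed
  finally show ?thesis by (simp add: add_mono)
qed

text \<open>Up to constants the integral of \<open>r / (\<phi> r * F r)\<close> over the dyadic interval at scale \<open>1 / 2 ^ j\<close>.
  Evaluating \<open>F\<close> at the larger radius \<open>4 / 2 ^ j\<close> makes a doubling estimate for \<open>F\<close> unnecessary.\<close>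

definition c :: "nat \<Rightarrow> real" where
  "c j = (1 / 2 ^ j)\<^sup>2 / (\<phi> (1 / 2 ^ j) * F (4 / 2 ^ j))"

lemma c_pos: "0 < c j"
  unfolding c_def by (intro divide_pos_pos mult_pos_pos phi_pos F_pos) auto

text \<open>With \<open>i = j - k\<close>, the bound of \<open>energy_pair\<close> multiplied by
  \<open>c j\<close> becomes, up to \<open>A\<close>,
  \<open>b / a + (\<phi> a / \<phi> b) * (b / a)\<^sup>2\<close>. The first term is
  \<open>(1 / 2) ^ i\<close>, the second at most \<open>D ^ i / 4 ^ i\<close>; both are dominated by
  \<open>(D / 4) ^ i\<close>.\<close>

lemma energy_scales:
  assumes "k \<le> j" "1 \<le> j"
  shows "(\<integral>\<^sup>+x. \<integral>\<^sup>+z. ennreal (\<bar>bump (1 / 2 ^ j) (del z) - bump (1 / 2 ^ j) (del x)\<bar>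
      * \<bar>bump (1 / 2 ^ k) (del z) - bump (1 / 2 ^ k) (del x)\<bar> / (dist z x)\<^sup>2) \<partial>\<nu> \<partial>\<mu>)
    \<le> ennreal (2 * A * (D / 4) ^ (j - k) / c j)"
proof -
  define b a where ba: "b = 1 / (2::real) ^ j" "a = 1 / (2::real) ^ k"
  define i where "i = j - k"
  have j: "j = k + i" using assms by (simp add: i_def)
  have b: "0 < b" "0 < a" "a = 2 ^ i * b" by (simp_all add: ba j power_add)
  have "(2::real) ^ 1 \<le> 2 ^ j" using assms by (intro power_increasing) auto
  then have b2: "2 * b \<le> 1" by (simp add: ba field_simps)
  have "1 * b \<le> 2 ^ i * b" using b by (intro mult_right_mono) auto
  then have ab: "b \<le> a" using b by simp
  have pos: "0 < \<phi> b" "0 < F (4 * b)" using b phi_pos F_pos by auto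
  have cj: "c j = b\<^sup>2 / (\<phi> b * F (4 * b))" by (simp add: c_def ba)
  have "F (4 * b) * (\<phi> b / (a * b) + \<phi> a / a\<^sup>2) * c j
      = b / a + (\<phi> a / \<phi> b) * (b / a)\<^sup>2"
    using pos b(1,2) by (simp add: cj field_simps power2_eq_square)
  also have "\<dots> \<le> (D / 4) ^ i + D ^ i * (1 / 2 ^ i)\<^sup>2"
  proof (intro add_mono mult_mono)
    have "b / a = (1 / 2) ^ i" using b by (simp add: power_divide)
    also have "\<dots> \<le> (D / 4) ^ i" using D_ge by (intro power_mono) auto
    finally show "b / a \<le> (D / 4) ^ i" .
    show "\<phi> a / \<phi> b \<le> D ^ i" using phi_pow[of b i] b pos by (simp add: field_simps)
    show "(b / a)\<^sup>2 \<le> (1 / 2 ^ i)\<^sup>2" using b by simp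
  qed (use D_ge in auto)
  also have "D ^ i * (1 / 2 ^ i)\<^sup>2 = (D / 4) ^ i"
    by (simp add: power2_eq_square power_divide flip: power_mult_distrib)
  finally have *: "F (4 * b) * (\<phi> b / (a * b) + \<phi> a / a\<^sup>2) * c j \<le> 2 * (D / 4) ^ i" by simp
  have "A * F (4 * b) * (\<phi> b / (a * b) + \<phi> a / a\<^sup>2) \<le> 2 * A * (D / 4) ^ i / c j"
    using mult_left_mono[OF *, of A] A_pos c_pos[of j] by (simp add: field_simps)
  then show ?thesis
    using energy_pair[OF b(1) ab b2] unfolding ba i_def by (blast intro: order_trans ennreal_leI)
qed

text \<open>The case \<open>j = k\<close> of \<open>energy_scales\<close> bounds the energy at scale
  \<open>j\<close> by a multiple of \<open>1 / c j\<close>. Among weights of total mass one, those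
  proportional to \<open>c j\<close> minimise the sum of squared weights over \<open>c j\<close>,
  and the minimum is the reciprocal of the sum of the \<open>c j\<close>.\<close>

definition test_fun :: "nat \<Rightarrow> nat \<Rightarrow> 'a \<Rightarrow> real" where
  "test_fun m n z = (\<Sum>j\<in>{m..<n}. c j * bump (1 / 2 ^ j) (del z)) / sum c {m..<n}"

text \<open>In the expanded square the pair \<open>k \<le> j\<close> has weight proportional to
  \<open>c k * c j\<close> and energy at most a multiple of \<open>(D / 4) ^ (j - k) / c j\<close>.
  The factor \<open>c j\<close> cancels, the sum over \<open>j\<close> is geometric, and the sum
  over \<open>k\<close> of \<open>c k\<close> removes one of the two normalising factors.\<close>

lemma energy_test_fun:
  assumes "1 \<le> m" "m < n"
  shows "(\<integral>\<^sup>+x. \<integral>\<^sup>+z. ennreal ((test_fun m n z - test_fun m n x)\<^sup>2 / (dist z x)\<^sup>2) \<partial>\<nu> \<partial>\<mu>)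
    \<le> ennreal (16 * A / (4 - D) / sum c {m..<n})"
proof -
  let ?I = "{m..<n}"
  define S where "S = sum c ?I"
  have S: "0 < S" unfolding S_def using assms c_pos by (intro sum_pos) auto
  define d where "d j z x = \<bar>bump (1 / 2 ^ j) (del z) - bump (1 / 2 ^ j) (del x)\<bar>" for j z x
  have d_nonneg: "0 \<le> d j z x" for j z x by (simp add: d_def)
  have d_meas [measurable]: "(\<lambda>(x, z). d j z x) \<in> borel_measurable (\<mu> \<Otimes>\<^sub>M \<nu>)" for j
    unfolding d_def by measurable
  \<comment> \<open>The weights absorb the factor 2 of \<open>sum_square_le\<close> and the
    restriction to ordered pairs.\<close>
  define w where "w k j = (if k \<le> j then 2 / S\<^sup>2 * c k * c j else 0)" for k j
  have w: "0 \<le> w k j" for k j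
    using c_pos[of k] c_pos[of j] S by (simp add: w_def)
  have "(\<integral>\<^sup>+x. \<integral>\<^sup>+z. ennreal ((test_fun m n z - test_fun m n x)\<^sup>2 / (dist z x)\<^sup>2) \<partial>\<nu> \<partial>\<mu>)
    \<le> (\<integral>\<^sup>+x. \<integral>\<^sup>+z. (\<Sum>k\<in>?I. \<Sum>j\<in>?I. ennreal (w k j) * ennreal (d j z x * d k z x / (dist z x)\<^sup>2)) \<partial>\<nu> \<partial>\<mu>)"
  proof (intro nn_integral_mono)
    fix x z
    let ?x = "\<lambda>j. c j * (bump (1 / 2 ^ j) (del z) - bump (1 / 2 ^ j) (del x))"
    have "test_fun m n z - test_fun m n x = sum ?x ?I / S"
      by (simp add: test_fun_def S_def diff_divide_distrib sum_subtractf right_diff_distrib)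
    then have "(test_fun m n z - test_fun m n x)\<^sup>2 / (dist z x)\<^sup>2
        = (sum ?x ?I)\<^sup>2 * (1 / S\<^sup>2 / (dist z x)\<^sup>2)"
      by (simp add: power_divide)
    also have "\<dots> \<le> 2 * (\<Sum>k\<in>?I. \<Sum>j\<in>?I. if k \<le> j then \<bar>?x j\<bar> * \<bar>?x k\<bar> else 0) * (1 / S\<^sup>2 / (dist z x)\<^sup>2)"
      by (intro mult_right_mono sum_square_le) auto
    also have "\<dots> = (\<Sum>k\<in>?I. \<Sum>j\<in>?I. w k j * (d j z x * d k z x / (dist z x)\<^sup>2))"
      unfolding sum_distrib_left sum_distrib_right
      by (intro sum.cong refl) (simp add: w_def d_def abs_mult c_pos less_imp_le)
    finally have "ennreal ((test_fun m n z - test_fun m n x)\<^sup>2 / (dist z x)\<^sup>2) \<le> ennreal \<dots>"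
      by (rule ennreal_leI)
    also have "\<dots> = (\<Sum>k\<in>?I. \<Sum>j\<in>?I. ennreal (w k j * (d j z x * d k z x / (dist z x)\<^sup>2)))"
      using w d_nonneg by (simp add: sum_nonneg del: times_divide_eq_right flip: sum_ennreal)
    also have "\<dots> = (\<Sum>k\<in>?I. \<Sum>j\<in>?I. ennreal (w k j) * ennreal (d j z x * d k z x / (dist z x)\<^sup>2))"
      by (intro sum.cong refl ennreal_mult' w)
    finally show "ennreal ((test_fun m n z - test_fun m n x)\<^sup>2 / (dist z x)\<^sup>2)
      \<le> (\<Sum>k\<in>?I. \<Sum>j\<in>?I. ennreal (w k j) * ennreal (d j z x * d k z x / (dist z x)\<^sup>2))" .
  qed
  also have "\<dots> = (\<Sum>k\<in>?I. \<Sum>j\<in>?I. ennreal (w k j) *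
      (\<integral>\<^sup>+x. \<integral>\<^sup>+z. ennreal (d j z x * d k z x / (dist z x)\<^sup>2) \<partial>\<nu> \<partial>\<mu>))"
    by (simp add: nn_integral_sum nn_integral_cmult d_def)
  also have "\<dots> \<le> (\<Sum>k\<in>?I. \<Sum>j\<in>?I. ennreal (4 * A / S\<^sup>2 * c k * (if k \<le> j then (D / 4) ^ (j - k) else 0)))"
  proof (intro sum_mono)
    fix k j assume kj: "k \<in> ?I" "j \<in> ?I"
    show "ennreal (w k j) * (\<integral>\<^sup>+x. \<integral>\<^sup>+z. ennreal (d j z x * d k z x / (dist z x)\<^sup>2) \<partial>\<nu> \<partial>\<mu>)
      \<le> ennreal (4 * A / S\<^sup>2 * c k * (if k \<le> j then (D / 4) ^ (j - k) else 0))"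
    proof (cases "k \<le> j")
      case True
      have "ennreal (w k j) * (\<integral>\<^sup>+x. \<integral>\<^sup>+z. ennreal (d j z x * d k z x / (dist z x)\<^sup>2) \<partial>\<nu> \<partial>\<mu>)
        \<le> ennreal (w k j) * ennreal (2 * A * (D / 4) ^ (j - k) / c j)"
        using kj True assms unfolding d_def by (intro mult_left_mono energy_scales) auto
      also have "\<dots> = ennreal (w k j * (2 * A * (D / 4) ^ (j - k) / c j))"
        using w by (intro ennreal_mult'[symmetric])
      also have "w k j * (2 * A * (D / 4) ^ (j - k) / c j) = 4 * A / S\<^sup>2 * c k * (D / 4) ^ (j - k)"
        using True c_pos[of j] by (simp add: w_def)
      finally show ?thesis using True by simp
    qed (simp add: w_def)
  qed
  also have "\<dots> = ennreal (\<Sum>k\<in>?I. \<Sum>j\<in>?I. 4 * A / S\<^sup>2 * c k * (if k \<le> j then (D / 4) ^ (j - k) else 0))"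
    using A_pos c_pos D_ge by (subst sum_ennreal; (intro sum_nonneg sum.cong refl sum_ennreal)?)
      (auto simp: less_imp_le)
  also have "\<dots> \<le> ennreal (\<Sum>k\<in>?I. 4 * A / S\<^sup>2 * c k * (1 / (1 - D / 4)))"
    unfolding sum_distrib_left[symmetric]
    using A_pos c_pos D_ge D_less
    by (intro ennreal_leI sum_mono mult_left_mono geometric_tail_le) (auto simp: less_imp_le)
  also have "(\<Sum>k\<in>?I. 4 * A / S\<^sup>2 * c k * (1 / (1 - D / 4))) = 4 * A / S\<^sup>2 * S * (1 / (1 - D / 4))"
    by (simp only: S_def sum_distrib_left sum_distrib_right)
  also have "\<dots> = 16 * A / (4 - D) / S"
    using S D_less by (simp add: field_simps power2_eq_square)
  finally show ?thesis unfolding S_def .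
qed

end

subsection \<open>Arcs and chords of the circle\<close>

text \<open>This bounds arcs by twice their chords. Halving the angle keeps the cosine above
  \<open>sqrt 2 / 2\<close>, so the mean value theorem bounds the sine of the half angle, and the
  double-angle formula returns to \<open>y\<close>.\<close>

lemma half_le_sin:
  assumes "0 \<le> y" "y \<le> pi / 2"
  shows "y / 2 \<le> sin y"
proof -
  define x where "x = y / 2"
  have x: "0 \<le> x" "x \<le> pi / 4" using assms by (auto simp: x_def)
  have c: "sqrt 2 / 2 \<le> cos t" if "0 \<le> t" "t \<le> pi / 4" for t
    using cos_monotone_0_pi_le[of t "pi / 4"] that by (simp add: cos_45)
  have "x * (sqrt 2 / 2) \<le> sin x"
  proof (cases "x = 0")
    case False
    have "\<exists>t>0. t < x \<and> sin x - sin 0 = (x - 0) * cos t"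
      using False x by (intro MVT2) (auto intro: DERIV_sin)
    then obtain t where t: "0 < t" "t < x" "sin x = x * cos t" by auto
    then show ?thesis using c[of t] x by (auto intro: mult_left_mono)
  qed simp
  then have "2 * (x * (sqrt 2 / 2)) * (sqrt 2 / 2) \<le> 2 * sin x * cos x"
    using x c[of x] sin_ge_zero[of x] by (intro mult_mono) auto
  also have "2 * (x * (sqrt 2 / 2)) * (sqrt 2 / 2) = x"
    by (simp add: field_simps)
  finally show ?thesis
    using sin_double[of x] by (simp add: x_def)
qed

lemma dist_cis: "dist (cis s) (cis t) = 2 * \<bar>sin ((s - t) / 2)\<bar>"
proof -
  have "(dist (cis s) (cis t))\<^sup>2 = (cos s - cos t)\<^sup>2 + (sin s - sin t)\<^sup>2"
    by (simp add: dist_norm cmod_power2)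
  also have "\<dots> = 2 - 2 * cos (s - t)"
    using sin_cos_squared_add[of s] sin_cos_squared_add[of t]
    by (simp add: power2_diff cos_diff algebra_simps)
  also have "\<dots> = (2 * \<bar>sin ((s - t) / 2)\<bar>)\<^sup>2"
  proof -
    have "cos (s - t) = 1 - 2 * (sin ((s - t) / 2))\<^sup>2"
      using cos_double_sin[of "(s - t) / 2"] by (simp only: nonzero_mult_div_cancel_left times_divide_eq_right)
    then show ?thesis by (simp add: power_mult_distrib)
  qed
  finally show ?thesis by (subst (asm) power2_eq_iff_nonneg) auto
qed

lemma dist_cis_le: "dist (cis s) (cis t) \<le> \<bar>s - t\<bar>"
  using abs_sin_x_le_abs_x[of "(s - t) / 2"] by (simp add: dist_cis)

lemma dist_cis_ge:
  assumes "\<bar>s - t\<bar> \<le> pi"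
  shows "\<bar>s - t\<bar> \<le> 2 * dist (cis s) (cis t)"
proof -
  have "\<bar>s - t\<bar> / 2 / 2 \<le> sin (\<bar>s - t\<bar> / 2)"
    using assms by (intro half_le_sin) auto
  also have "\<dots> \<le> \<bar>sin ((s - t) / 2)\<bar>"
    using sin_minus[of "(s - t) / 2"] by (auto simp: abs_if minus_divide_left simp del: sin_minus)
  finally show ?thesis by (simp add: dist_cis)
qed

lemma circle_eq_cis: "x \<in> circle \<Longrightarrow> x = cis (Arg x)"
  using cis_Arg[of x] by (cases "x = 0") (auto simp: sgn_div_norm)

lemma arc_dist_le:
  assumes "z \<in> circle" "w \<in> circle"
  shows "arc_dist z w \<le> 2 * dist z w"
proof -
  have w: "w \<noteq> 0" using assms by auto
  have "z / w = cis (Arg (z / w))"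
    using assms by (intro circle_eq_cis) (auto simp: norm_divide)
  then have "dist (cis (Arg (z / w))) (cis 0) = dist (z / w) 1" by simp
  also have "\<dots> = norm ((z - w) / w)" using w by (simp add: dist_norm diff_divide_distrib)
  also have "\<dots> = dist z w" using assms by (simp add: norm_divide dist_norm)
  finally have "dist (cis (Arg (z / w))) (cis 0) = dist z w" .
  then show ?thesis
    using dist_cis_ge[of "Arg (z / w)" 0] Arg_bounded[of "z / w"]
    unfolding arc_dist_def by (simp add: abs_le_iff)
qed

text \<open>\<open>Arg\<close> jumps across the negative axis, whereas this expression is continuous
  and increasing in the chord. It yields the measurability of arcs and the comparison of nearest
  points.\<close>

lemma arc_dist_arccos:
  assumes "z \<in> circle" "w \<in> circle"
  shows "arc_dist z w = arccos (1 - (dist z w)\<^sup>2 / 2)"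
proof -
  have w: "w \<noteq> 0" and z: "z \<noteq> 0" using assms by auto
  have "Re (z / w) = Re (z * cnj w)"
    using assms w by (subst complex_div_cnj) simp
  also have "\<dots> = 1 - (dist z w)\<^sup>2 / 2"
  proof -
    have "(Re z)\<^sup>2 + (Im z)\<^sup>2 = 1" "(Re w)\<^sup>2 + (Im w)\<^sup>2 = 1"
      using assms by (simp_all flip: cmod_power2)
    then show ?thesis
      by (simp add: dist_norm cmod_power2 power2_diff field_simps)
  qed
  finally have "cos (Arg (z / w)) = 1 - (dist z w)\<^sup>2 / 2"
    using assms w z by (subst cos_Arg) (auto simp: norm_divide)
  then show ?thesis
    using arccos_cos_eq_abs[of "Arg (z / w)"] Arg_bounded[of "z / w"]
    by (simp add: arc_dist_def abs_le_iff)
qed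

lemma arccos_chord_mono:
  assumes "0 \<le> x" "x \<le> y" "y \<le> 2"
  shows "arccos (1 - x\<^sup>2 / 2) \<le> arccos (1 - y\<^sup>2 / 2)"
proof -
  have "x\<^sup>2 \<le> y\<^sup>2" "y\<^sup>2 \<le> 2\<^sup>2" using assms by (intro power_mono; simp)+
  then show ?thesis by (intro arccos_le_arccos) auto
qed

lemma continuous_on_arc_dist_circle:
  "continuous_on {0..2} (\<lambda>x. arccos (1 - x\<^sup>2 / 2))"
proof (intro continuous_intros ballI conjI)
  fix x :: real assume "x \<in> {0..2}"
  then have "x\<^sup>2 \<le> 2\<^sup>2" by (intro power_mono) auto
  then show "- 1 \<le> 1 - x\<^sup>2 / 2" "1 - x\<^sup>2 / 2 \<le> 1" by auto
qed auto

lemma dist_circle_le: "z \<in> circle \<Longrightarrow> w \<in> circle \<Longrightarrow> dist z w \<le> 2"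
  using dist_triangle[of z w 0] by (simp add: dist_commute)

section \<open>Arc length as a measure and its mass on chordal balls\<close>

lemma sets_arc_length [measurable_cong]: "sets arc_length = sets (restrict_space borel circle)"
  and space_arc_length [simp]: "space arc_length = circle"
  by (simp_all add: arc_length_def space_restrict_space)

lemma sets_circle_measure [measurable_cong]: "sets circle_measure = sets (restrict_space borel circle)"
  and space_circle_measure [simp]: "space circle_measure = circle"
  by (simp_all add: circle_measure_def space_scale_measure sets_arc_length)

lemma cis_measurable_circle [measurable]:
  "cis \<in> restrict_space lborel {0..<2*pi} \<rightarrow>\<^sub>M restrict_space borel circle"
  by (intro measurable_restrict_space2 measurable_restrict_space1)
    (auto intro!: borel_measurable_continuous_onI continuous_intros)

lemma id_measurable_circle: "(\<lambda>x. x) \<in> borel_measurable (restrict_space borel circle)"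
  by (intro measurable_restrict_space1) simp

lemma emeasure_arc_length:
  assumes "A \<in> sets (restrict_space borel circle)"
  shows "emeasure arc_length A = emeasure lborel {t \<in> {0..<2*pi}. cis t \<in> A}"
proof -
  have "emeasure arc_length A = emeasure (restrict_space lborel {0..<2*pi})
      (cis -` A \<inter> space (restrict_space lborel {0..<2*pi}))"
    unfolding arc_length_def using assms by (intro emeasure_distr) measurable
  also have "\<dots> = emeasure lborel (cis -` A \<inter> space (restrict_space lborel {0..<2*pi}))"
    by (intro emeasure_restrict_space) (auto simp: space_restrict_space)
  also have "cis -` A \<inter> space (restrict_space lborel {0..<2*pi}) = {t \<in> {0..<2*pi}. cis t \<in> A}"
    by (auto simp: space_restrict_space)
  finally show ?thesis .
qed

lemma emeasure_arc_length_circle: "emeasure arc_length circle = ennreal (2 * pi)"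
proof -
  have "circle \<in> sets (restrict_space borel circle)"
    using sets.top[of "restrict_space borel circle"] by (simp add: space_restrict_space)
  then have "emeasure arc_length circle = emeasure lborel {t \<in> {0..<2*pi}. cis t \<in> circle}"
    by (rule emeasure_arc_length)
  also have "{t \<in> {0..<2*pi}. cis t \<in> circle} = {0..<2*pi}" by auto
  finally show ?thesis by simp
qed

lemma finite_measure_arc_length: "finite_measure arc_length"
  by standard (simp add: emeasure_arc_length_circle)

lemma finite_measure_circle: "finite_measure circle_measure"
  by standard (simp add: circle_measure_def space_scale_measure emeasure_arc_length_circle
      ennreal_mult_eq_top_iff)

lemma ball_in_sets_circle: "{z \<in> circle. dist z x < r} \<in> sets (restrict_space borel circle)"
proof -
  note [measurable] = id_measurable_circle
  have "{z \<in> space (restrict_space borel circle). dist z x < r} \<in> sets (restrict_space borel circle)"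
    by measurable
  then show ?thesis by (simp add: space_restrict_space)
qed

lemma emeasure_lborel_interval: "0 \<le> r \<Longrightarrow> emeasure lborel {x - r<..<x + r} = ennreal (2 * r)"
  by simp

text \<open>An angle whose chord to \<open>x\<close> is below \<open>r\<close> differs from
  \<open>s\<close> by less than \<open>2 * r\<close> modulo \<open>2 * pi\<close>. Three intervals
  of length \<open>4 * r\<close> therefore cover all such angles in the parameter range, which gives
  12.\<close>

lemma arc_length_ball_le:
  assumes x: "x \<in> circle" and r: "0 < r"
  shows "emeasure arc_length {z \<in> circle. dist z x < r} \<le> ennreal (12 * r)"
proof -
  define s where "s = Arg2pi x"
  have s: "0 \<le> s" "s < 2 * pi" "x = cis s"
    using Arg2pi[of x] x by (auto simp: s_def is_Arg_def cis_conv_exp)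
  let ?J = "\<lambda>c. {c - 2 * r<..<c + 2 * r}"
  have "{t \<in> {0..<2*pi}. cis t \<in> {z \<in> circle. dist z x < r}} \<subseteq> ?J s \<union> ?J (s + 2 * pi) \<union> ?J (s - 2 * pi)"
  proof
    fix t assume t: "t \<in> {t \<in> {0..<2*pi}. cis t \<in> {z \<in> circle. dist z x < r}}"
    then have d: "dist (cis t) (cis s) < r" using s by simp
    consider "\<bar>t - s\<bar> \<le> pi" | "t - s > pi" | "t - s < - pi" by linarith
    then show "t \<in> ?J s \<union> ?J (s + 2 * pi) \<union> ?J (s - 2 * pi)"
    proof cases
      case 1
      then have "\<bar>t - s\<bar> < 2 * r" using dist_cis_ge[of t s] d by linarith
      then show ?thesis by auto
    next
      case 2
      have "cis (s + 2 * pi) = cis s" by (simp add: complex_eq_iff)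
      moreover have "\<bar>t - (s + 2 * pi)\<bar> \<le> pi" using 2 t s by auto
      ultimately have "\<bar>t - (s + 2 * pi)\<bar> < 2 * r"
        using dist_cis_ge[of t "s + 2 * pi"] d by simp
      then show ?thesis by auto
    next
      case 3
      have "cis (s - 2 * pi) = cis s" by (simp add: complex_eq_iff cos_diff sin_diff)
      moreover have "\<bar>t - (s - 2 * pi)\<bar> \<le> pi" using 3 t s by auto
      ultimately have "\<bar>t - (s - 2 * pi)\<bar> < 2 * r"
        using dist_cis_ge[of t "s - 2 * pi"] d by simp
      then show ?thesis by auto
    qed
  qed
  then have "emeasure arc_length {z \<in> circle. dist z x < r}
      \<le> emeasure lborel (?J s \<union> ?J (s + 2 * pi) \<union> ?J (s - 2 * pi))"
    by (subst emeasure_arc_length[OF ball_in_sets_circle]) (intro emeasure_mono, auto)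
  also have "\<dots> \<le> emeasure lborel (?J s) + emeasure lborel (?J (s + 2 * pi)) + emeasure lborel (?J (s - 2 * pi))"
    by (intro order_trans[OF emeasure_subadditive] add_right_mono emeasure_subadditive) auto
  also have "\<dots> = ennreal (2 * (2 * r)) + ennreal (2 * (2 * r)) + ennreal (2 * (2 * r))"
    using r by (simp only: emeasure_lborel_interval)
  also have "\<dots> = ennreal (12 * r)"
    using r by (simp flip: ennreal_plus)
  finally show ?thesis .
qed

lemma arc_length_ball_ge:
  assumes x: "x \<in> circle" and r: "0 < r" "r \<le> 1"
  shows "ennreal r \<le> emeasure arc_length {z \<in> circle. dist z x < r}"
proof -
  define s where "s = Arg2pi x"
  have s: "0 \<le> s" "s < 2 * pi" "x = cis s"
    using Arg2pi[of x] x by (auto simp: s_def is_Arg_def cis_conv_exp)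
  \<comment> \<open>A one-sided interval suffices; the side is chosen so that it does not leave the
    parameter range.\<close>
  define J where "J = (if pi \<le> s then {s - r<..<s} else {s<..<s + r})"
  have "J \<subseteq> {t \<in> {0..<2*pi}. cis t \<in> {z \<in> circle. dist z x < r}}"
  proof
    fix t assume t: "t \<in> J"
    then have "\<bar>t - s\<bar> < r" "0 \<le> t" "t < 2 * pi"
      using s r pi_ge_two by (auto simp: J_def split: if_splits)
    then show "t \<in> {t \<in> {0..<2*pi}. cis t \<in> {z \<in> circle. dist z x < r}}"
      using dist_cis_le[of t s] s by auto
  qed
  then have "emeasure lborel J \<le> emeasure arc_length {z \<in> circle. dist z x < r}"
  proof (subst emeasure_arc_length[OF ball_in_sets_circle], intro emeasure_mono)
    have "(\<lambda>t. dist (cis t) x) \<in> borel_measurable borel"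
      by (intro borel_measurable_continuous_onI continuous_intros)
    then have "{t. dist (cis t) x < r} \<in> sets borel" by measurable
    moreover have "{t \<in> {0..<2*pi}. cis t \<in> {z \<in> circle. dist z x < r}} = {0..<2*pi} \<inter> {t. dist (cis t) x < r}"
      by auto
    ultimately show "{t \<in> {0..<2*pi}. cis t \<in> {z \<in> circle. dist z x < r}} \<in> sets lborel" by simp
  qed
  moreover have "emeasure lborel J = ennreal r"
    using r by (simp add: J_def)
  ultimately show ?thesis by simp
qed

section \<open>Arcs and arc neighbourhoods as Borel sets\<close>

lemma open_arc_eq:
  assumes "\<zeta> \<in> circle"
  shows "open_arc \<zeta> t = {x \<in> circle. arc_dist x \<zeta> < t}"
proof (intro subset_antisym subsetI)
  have z: "\<zeta> \<noteq> 0" using assms by auto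
  fix x assume "x \<in> open_arc \<zeta> t"
  then obtain \<theta> where th: "x = \<zeta> * cis \<theta>" "\<bar>\<theta>\<bar> < t" by (auto simp: open_arc_def)
  \<comment> \<open>The principal argument has the least absolute value among all angles of a
    point.\<close>
  have "\<bar>Arg (cis \<theta>)\<bar> \<le> \<bar>\<theta>\<bar>"
  proof (cases "-pi < \<theta> \<and> \<theta> \<le> pi")
    case True
    then have "Arg (cis \<theta>) = \<theta>" by (intro cis_Arg_unique) auto
    then show ?thesis by simp
  next
    case False
    then show ?thesis using Arg_bounded[of "cis \<theta>"] by auto
  qed
  then show "x \<in> {x \<in> circle. arc_dist x \<zeta> < t}"
    using th assms z by (auto simp: arc_dist_def norm_mult)
next
  have z: "\<zeta> \<noteq> 0" using assms by auto
  fix x assume x: "x \<in> {x \<in> circle. arc_dist x \<zeta> < t}"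
  then have "x / \<zeta> = cis (Arg (x / \<zeta>))"
    using assms by (intro circle_eq_cis) (auto simp: norm_divide)
  then have "x = \<zeta> * cis (Arg (x / \<zeta>))" using z by (simp add: field_simps)
  with x show "x \<in> open_arc \<zeta> t" unfolding open_arc_def arc_dist_def by blast
qed

text \<open>Monotonicity of \<open>emeasure\<close> requires the larger set to be measurable, and
  arcs will serve as the larger sets.\<close>

lemma open_arc_in_sets:
  assumes "\<zeta> \<in> circle"
  shows "open_arc \<zeta> t \<in> sets (restrict_space borel circle)"
proof -
  have "continuous_on circle (\<lambda>x. arccos (1 - (dist x \<zeta>)\<^sup>2 / 2))"
    using assms by (intro continuous_on_compose2[OF continuous_on_arc_dist_circle] continuous_intros)
      (auto intro!: dist_circle_le[simplified])
  then have [measurable]: "(\<lambda>x. arccos (1 - (dist x \<zeta>)\<^sup>2 / 2)) \<in> borel_measurable (restrict_space borel circle)"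
    by (rule borel_measurable_continuous_on_restrict)
  have "open_arc \<zeta> t = {x \<in> space (restrict_space borel circle). arccos (1 - (dist x \<zeta>)\<^sup>2 / 2) < t}"
    using assms by (auto simp: open_arc_eq space_restrict_space arc_dist_arccos)
  also have "\<dots> \<in> sets (restrict_space borel circle)" by measurable
  finally show ?thesis .
qed

text \<open>Since \<open>E\<close> is closed, the chordal distance is attained at some
  \<open>e\<close>. Arc distance increases with the chord, so the same \<open>e\<close> minimises
  it.\<close>

lemma arc_nbhd_eq:
  assumes "closed E" "E \<subseteq> circle" "E \<noteq> {}" "0 \<le> t"
  shows "arc_nbhd E t = {z \<in> circle. arccos (1 - (infdist z E)\<^sup>2 / 2) \<le> t}"
proof -
  have "(INF w\<in>E. ennreal (arc_dist z w)) = ennreal (arccos (1 - (infdist z E)\<^sup>2 / 2))"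
    if z: "z \<in> circle" for z
  proof -
    obtain e where e: "e \<in> E" "infdist z E = dist z e"
      using infdist_attains_inf[OF assms(1,3)] by blast
    have "(INF w\<in>E. ennreal (arc_dist z w)) = ennreal (arc_dist z e)"
    proof (intro antisym INF_lower e INF_greatest ennreal_leI)
      fix w assume w: "w \<in> E"
      then have "dist z e \<le> dist z w" using infdist_le[of w E z] e by simp
      then show "arc_dist z e \<le> arc_dist z w"
        using z w e assms(2) dist_circle_le[of z w]
        by (subst (1 2) arc_dist_arccos) (auto intro!: arccos_chord_mono)
    qed
    then show ?thesis using e z assms(2) arc_dist_arccos[of z e] by auto
  qed
  then show ?thesis using assms(4) by (auto simp: arc_nbhd_def)
qed

lemma infdist_circle_le:
  assumes "E \<subseteq> circle" "E \<noteq> {}" "norm z = 1"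
  shows "infdist z E \<le> 2"
  proof -
  obtain e where e: "e \<in> E" using assms(2) by auto
  then have "dist z e \<le> 2" using assms by (intro dist_circle_le) auto
  with e show ?thesis by (rule infdist_le2)
qed

lemma arc_nbhd_in_sets:
  assumes "closed E" "E \<subseteq> circle" "E \<noteq> {}" "0 \<le> t"
  shows "arc_nbhd E t \<in> sets (restrict_space borel circle)"
proof -
  have "continuous_on circle (\<lambda>x. arccos (1 - (infdist x E)\<^sup>2 / 2))"
    using assms by (intro continuous_on_compose2[OF continuous_on_arc_dist_circle] continuous_intros)
      (auto simp: infdist_nonneg dest: infdist_circle_le[OF assms(2,3)])
  then have [measurable]: "(\<lambda>x. arccos (1 - (infdist x E)\<^sup>2 / 2)) \<in> borel_measurable (restrict_space borel circle)"
    by (rule borel_measurable_continuous_on_restrict)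
  have "arc_nbhd E t = {x \<in> space (restrict_space borel circle). arccos (1 - (infdist x E)\<^sup>2 / 2) \<le> t}"
    using assms by (simp add: arc_nbhd_eq space_restrict_space)
  also have "\<dots> \<in> sets (restrict_space borel circle)" by measurable
  finally show ?thesis .
qed

lemma arc_nbhd_superset:
  assumes "E \<subseteq> circle" "E \<noteq> {}" "2 * r \<le> t"
  shows "{z \<in> circle. infdist z E < r} \<subseteq> arc_nbhd E t"
proof clarify
  fix z assume z: "z \<in> circle" "infdist z E < r"
  then obtain e where e: "e \<in> E" "dist z e < r"
    using assms(2) by (auto simp: infdist_def cINF_less_iff)
  have "(INF w\<in>E. ennreal (arc_dist z w)) \<le> ennreal (arc_dist z e)"
    using e by (intro INF_lower)
  also have "\<dots> \<le> ennreal t"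
    using arc_dist_le[of z e] z e assms by (intro ennreal_leI) auto
  finally show "z \<in> arc_nbhd E t" using z by (simp add: arc_nbhd_def)
qed

subsection \<open>Boundary values of Poisson integrals\<close>

lemma circle_measure_density:
  "circle_measure = density arc_length (\<lambda>_. ennreal (1 / (2 * pi)))"
  by (rule measure_eqI)
    (simp_all add: circle_measure_def emeasure_density nn_integral_cmult)

lemma measure_circle: "measure circle_measure circle = 1"
  by (simp add: measure_def circle_measure_def emeasure_arc_length_circle flip: ennreal_mult')

lemma continuous_circle_measurable:
  fixes f :: "complex \<Rightarrow> 'b :: topological_space"
  assumes "continuous_on circle f"
  shows "f \<in> measurable circle_measure borel" "f \<in> measurable arc_length borel"
  using borel_measurable_continuous_on_restrict[OF assms]
  by (simp_all cong: measurable_cong_sets add: sets_circle_measure sets_arc_length)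

lemma continuous_circle_integrable:
  fixes f :: "complex \<Rightarrow> 'b :: {banach, second_countable_topology}"
  assumes f: "continuous_on circle f"
  shows "integrable circle_measure f"
proof -
  interpret finite_measure circle_measure by (rule finite_measure_circle)
  have "compact (f ` circle)" using f by (intro compact_continuous_image) auto
  then obtain B where "\<And>z. z \<in> circle \<Longrightarrow> norm (f z) \<le> B"
    using compact_imp_bounded bounded_iff by (metis imageI)
  then show ?thesis
    using continuous_circle_measurable(1)[OF f]
    by (intro integrable_const_bound[of _ B]) (auto intro!: AE_I2)
qed

text \<open>Passes from the Bochner integral over the circle to the gauge integral over
  \<open>{0..2*pi}\<close>, the form in which contour integrals are given; the extra endpoint is
  negligible.\<close>

lemma circle_integral_eq:
  fixes f :: "complex \<Rightarrow> 'b :: euclidean_space"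
  assumes f: "continuous_on circle f" and I: "((\<lambda>t. f (cis t)) has_integral I) {0..2*pi}"
  shows "integral\<^sup>L circle_measure f = (1 / (2 * pi)) *\<^sub>R I"
proof -
  have meas: "f \<in> measurable arc_length borel"
    by (rule continuous_circle_measurable(2)[OF f])
  have c: "continuous_on {0..2*pi} (\<lambda>t. f (cis t))"
    by (intro continuous_on_compose2[OF f] continuous_intros) auto
  then have "set_integrable lborel {0..2*pi} (\<lambda>t. f (cis t))"
    unfolding set_integrable_def by (intro borel_integrable_compact) auto
  then have si: "set_integrable lborel {0..<2*pi} (\<lambda>t. f (cis t))"
    by (rule set_integrable_subset) auto
  have "integral\<^sup>L circle_measure f = (1 / (2 * pi)) *\<^sub>R integral\<^sup>L arc_length f"
    unfolding circle_measure_density using meas by (subst integral_density) auto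
  also have "integral\<^sup>L arc_length f = integral\<^sup>L (restrict_space lborel {0..<2*pi}) (\<lambda>t. f (cis t))"
    unfolding arc_length_def
    by (rule integral_distr[OF cis_measurable_circle borel_measurable_continuous_on_restrict[OF f]])
  also have "\<dots> = (LINT t:{0..<2*pi}|lborel. f (cis t))"
    unfolding set_lebesgue_integral_def by (intro integral_restrict_space) auto
  also have "\<dots> = integral {0..<2*pi} (\<lambda>t. f (cis t))"
    using si by (rule set_borel_integral_eq_integral)
  also have "\<dots> = integral {0..2*pi} (\<lambda>t. f (cis t))"
  proof (rule integral_spike_set)
    have "{t \<in> {0..2*pi} - {0..<2*pi}. f (cis t) \<noteq> 0} \<subseteq> {2*pi}" by auto
    then show "negligible {t \<in> {0..2*pi} - {0..<2*pi}. f (cis t) \<noteq> 0}"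
      by (rule negligible_subset[rotated]) simp
    have "{t \<in> {0..<2*pi} - {0..2*pi}. f (cis t) \<noteq> 0} = {}" by auto
    then show "negligible {t \<in> {0..<2*pi} - {0..2*pi}. f (cis t) \<noteq> 0}"
      by (simp only: negligible_empty)
  qed
  also have "\<dots> = I"
    using I by (rule integral_unique)
  finally show ?thesis .
qed

lemma circle_minus_nz: "norm (z :: complex) < 1 \<Longrightarrow> \<zeta> \<in> circle \<Longrightarrow> \<zeta> - z \<noteq> 0"
  by auto

text \<open>On the circle the kernel equals \<open>2 * Re (\<zeta> / (\<zeta> - z)) - 1\<close>, and
  the mean of \<open>\<zeta> / (\<zeta> - z)\<close> is 1 by Cauchy's formula for the constant
  function 1.\<close>

lemma poisson_kernel_integral:
  assumes z: "norm z < 1"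
  shows "(LINT \<zeta>|circle_measure. (1 - (norm z)\<^sup>2) / (norm (\<zeta> - z))\<^sup>2) = 1"
proof -
  let ?f = "\<lambda>\<zeta>. \<zeta> / (\<zeta> - z)"
  have f: "continuous_on circle ?f"
    using z by (intro continuous_intros) auto
  have "((\<lambda>u. 1 / (u - z)) has_contour_integral 2 * of_real pi * \<i> * 1) (circlepath 0 1)"
    using z by (intro Cauchy_integral_circlepath_simple) (auto intro: holomorphic_intros)
  then have "((\<lambda>t. 1 / (cis t - z) * \<i> * cis t) has_integral 2 * of_real pi * \<i>) {0..2*pi}"
    unfolding circlepath_def by (subst (asm) has_contour_integral_part_circlepath_iff) auto
  moreover have eq: "- (\<i> * 2 * complex_of_real pi * \<i>) = 2 * of_real pi"
    by (simp add: complex_eq_iff)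
  \<comment> \<open>The derivative of \<open>cis t\<close> contributes a factor \<open>\<i>\<close>;
    multiplying by \<open>- \<i>\<close> leaves the angular integral of \<open>?f\<close>.\<close>
  ultimately have "((\<lambda>t. - \<i> * (1 / (cis t - z) * \<i> * cis t)) has_integral - \<i> * (2 * of_real pi * \<i>)) {0..2*pi}"
    by (intro has_integral_mult_right)
  then
  have "((\<lambda>t. ?f (cis t)) has_integral 2 * of_real pi) {0..2*pi}"
    by (simp add: mult.assoc mult.left_commute[of _ \<i>] eq flip: mult.assoc)
  from circle_integral_eq[OF f this] have *: "integral\<^sup>L circle_measure ?f = 1"
    by (simp add: scaleR_conv_of_real)
  interpret finite_measure circle_measure by (rule finite_measure_circle)
  have "(LINT \<zeta>|circle_measure. (1 - (norm z)\<^sup>2) / (norm (\<zeta> - z))\<^sup>2)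
    = (LINT \<zeta>|circle_measure. 2 * Re (?f \<zeta>) - 1)"
  proof (intro Bochner_Integration.integral_cong refl)
    fix \<zeta> assume "\<zeta> \<in> space circle_measure"
    then have zt: "\<zeta> \<in> circle" by simp
    then have nz: "\<zeta> - z \<noteq> 0" using z by (rule circle_minus_nz[rotated])
    have "Re (?f \<zeta>) = Re (\<zeta> * cnj (\<zeta> - z)) / (norm (\<zeta> - z))\<^sup>2"
      by (subst complex_div_cnj) simp
    moreover have "2 * Re (\<zeta> * cnj (\<zeta> - z)) - (norm (\<zeta> - z))\<^sup>2 = (norm \<zeta>)\<^sup>2 - (norm z)\<^sup>2"
      unfolding cmod_power2 by (simp add: power2_eq_square algebra_simps)
    ultimately show "(1 - (norm z)\<^sup>2) / (norm (\<zeta> - z))\<^sup>2 = 2 * Re (?f \<zeta>) - 1"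
      using zt nz by (simp add: field_simps)
  qed
  also have "\<dots> = 2 * Re (integral\<^sup>L circle_measure ?f) - measure circle_measure circle"
    using continuous_circle_integrable[OF f]
    by (subst Bochner_Integration.integral_diff) auto
  also have "\<dots> = 1"
    by (simp add: * measure_circle)
  finally show ?thesis .
qed

text \<open>Since the kernel times \<open>(norm (\<zeta> - z))\<^sup>2\<close> is constant, splitting
  \<open>norm (\<zeta> - z)\<close> by the inequality of means needs only the total mass of the kernel.\<close>

lemma poisson_integral_lipschitz:
  assumes z: "norm z < 1" and xi: "\<xi> \<in> circle"
    and u: "\<And>v w. v \<in> circle \<Longrightarrow> w \<in> circle \<Longrightarrow> norm (u v - u w) \<le> L * norm (v - w)"
  shows "norm (poisson_integral u z - u \<xi>) \<le> L * (norm (z - \<xi>) + sqrt (1 - (norm z)\<^sup>2))"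
proof -
  define p where "p \<zeta> = (1 - (norm z)\<^sup>2) / (norm (\<zeta> - z))\<^sup>2" for \<zeta>
  define s where "s = sqrt (1 - (norm z)\<^sup>2)"
  have z2: "(norm z)\<^sup>2 < 1" using z by (simp add: abs_square_less_1)
  then have s: "0 < s" "s\<^sup>2 = 1 - (norm z)\<^sup>2" by (auto simp: s_def)
  have L: "0 \<le> L"
    using u[of 1 "-1"] order_trans[OF norm_ge_zero u[of 1 "-1"]] by (simp add: zero_le_mult_iff)
  have "L-lipschitz_on circle u"
    using u L by (intro lipschitz_onI) (auto simp: dist_norm)
  then have cu: "continuous_on circle u" by (rule lipschitz_on_continuous_on)
  have cp: "continuous_on circle p"
    unfolding p_def using z by (intro continuous_intros) auto
  have ip: "integrable circle_measure p" by (rule continuous_circle_integrable[OF cp])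
  have p1: "integral\<^sup>L circle_measure p = 1"
    unfolding p_def by (rule poisson_kernel_integral[OF z])
  interpret finite_measure circle_measure by (rule finite_measure_circle)
  have "poisson_integral u z - u \<xi> = (LINT \<zeta>|circle_measure. p \<zeta> *\<^sub>R u \<zeta>) - (LINT \<zeta>|circle_measure. p \<zeta> *\<^sub>R u \<xi>)"
    using ip p1 by (simp add: poisson_integral_def flip: p_def)
  also have "\<dots> = (LINT \<zeta>|circle_measure. p \<zeta> *\<^sub>R (u \<zeta> - u \<xi>))"
    using cu cp unfolding scaleR_diff_right
    by (intro Bochner_Integration.integral_diff[symmetric] continuous_circle_integrable continuous_intros)
  also have "norm \<dots> \<le> (LINT \<zeta>|circle_measure. norm (p \<zeta> *\<^sub>R (u \<zeta> - u \<xi>)))"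
    by (rule integral_norm_bound)
  also have "\<dots> \<le> (LINT \<zeta>|circle_measure. L * (norm (z - \<xi>) * p \<zeta> + (s * p \<zeta> + s) / 2))"
  proof (intro integral_mono continuous_circle_integrable)
    fix \<zeta> assume "\<zeta> \<in> space circle_measure"
    then have zt: "\<zeta> \<in> circle" by simp
    have n: "0 < norm (\<zeta> - z)" using circle_minus_nz[OF z zt] by simp
    have p0: "0 \<le> p \<zeta>" using z2 by (simp add: p_def)
    have ps: "p \<zeta> * (norm (\<zeta> - z))\<^sup>2 = s\<^sup>2" using n s by (simp add: p_def)
    have "2 * s * norm (\<zeta> - z) \<le> s\<^sup>2 + (norm (\<zeta> - z))\<^sup>2"
      by (rule sum_squares_bound)
    then have "p \<zeta> * (2 * s * norm (\<zeta> - z)) \<le> p \<zeta> * (s\<^sup>2 + (norm (\<zeta> - z))\<^sup>2)"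
      using p0 by (rule mult_left_mono)
    also have "\<dots> = s * (p \<zeta> * s + s)"
      by (simp add: distrib_left ps) (simp add: power2_eq_square)
    finally have "s * (2 * (p \<zeta> * norm (\<zeta> - z))) \<le> s * (p \<zeta> * s + s)" by (simp add: ac_simps)
    then have "p \<zeta> * norm (\<zeta> - z) \<le> (s * p \<zeta> + s) / 2"
      using s(1) by (simp add: mult.commute)
    moreover have "norm (\<zeta> - \<xi>) \<le> norm (z - \<xi>) + norm (\<zeta> - z)"
      using norm_triangle_ineq[of "z - \<xi>" "\<zeta> - z"] by simp
    then have "p \<zeta> * norm (\<zeta> - \<xi>) \<le> p \<zeta> * (norm (z - \<xi>) + norm (\<zeta> - z))"
      using p0 by (rule mult_left_mono)
    ultimately have *: "p \<zeta> * norm (\<zeta> - \<xi>) \<le> norm (z - \<xi>) * p \<zeta> + (s * p \<zeta> + s) / 2"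
      unfolding distrib_left mult.commute[of "norm (z - \<xi>)"] by linarith
    have "norm (p \<zeta> *\<^sub>R (u \<zeta> - u \<xi>)) \<le> p \<zeta> * (L * norm (\<zeta> - \<xi>))"
      using u[OF zt xi] p0 by (simp add: mult_left_mono)
    also have "\<dots> \<le> L * (norm (z - \<xi>) * p \<zeta> + (s * p \<zeta> + s) / 2)"
      using mult_left_mono[OF * L] by (simp add: ac_simps)
    finally show "norm (p \<zeta> *\<^sub>R (u \<zeta> - u \<xi>)) \<le> L * (norm (z - \<xi>) * p \<zeta> + (s * p \<zeta> + s) / 2)" .
  qed (use cu cp in \<open>auto intro!: continuous_intros\<close>)
  also have "\<dots> = L * (norm (z - \<xi>) + (s + s) / 2)"
    using ip p1 measure_circle by simp
  finally show ?thesis by (simp add: s_def)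
qed

text \<open>The error bound of \<open>poisson_integral_lipschitz\<close> tends to 0 under any
  approach from inside the disc, so every aperture is covered at once.\<close>

lemma poisson_nontangential_limit:
  assumes xi: "\<xi> \<in> circle"
    and u: "\<And>v w. v \<in> circle \<Longrightarrow> w \<in> circle \<Longrightarrow> norm (u v - u w) \<le> L * norm (v - w)"
  shows "has_nontangential_limit (poisson_integral u) \<xi> (u \<xi>)"
  unfolding has_nontangential_limit_def
proof (intro allI impI)
  fix \<kappa> :: real
  let ?F = "at \<xi> within stolz_region \<kappa> \<xi>"
  have "((\<lambda>z. L * (norm (z - \<xi>) + sqrt (1 - (norm z)\<^sup>2))) \<longlongrightarrow>
      L * (norm (\<xi> - \<xi>) + sqrt (1 - (norm \<xi>)\<^sup>2))) ?F"
    by (intro tendsto_intros)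
  then have lim: "((\<lambda>z. L * (norm (z - \<xi>) + sqrt (1 - (norm z)\<^sup>2))) \<longlongrightarrow> 0) ?F"
    using xi by simp
  have "\<forall>\<^sub>F z in ?F. z \<in> stolz_region \<kappa> \<xi>"
    by (simp add: eventually_at_filter)
  then have "\<forall>\<^sub>F z in ?F. norm (poisson_integral u z - u \<xi>) \<le> L * (norm (z - \<xi>) + sqrt (1 - (norm z)\<^sup>2))"
    by eventually_elim
      (rule poisson_integral_lipschitz[OF _ xi u], auto simp: stolz_region_def)
  then have "((\<lambda>z. poisson_integral u z - u \<xi>) \<longlongrightarrow> 0) ?F"
    using lim by (rule Lim_null_comparison)
  then show "(poisson_integral u \<longlongrightarrow> u \<xi>) ?F"
    by (rule LIM_zero_cancel)
qed

text \<open>Uniqueness needs \<open>\<xi>\<close> to be a limit point of a Stolz region. The radial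
  points \<open>(1 - d) *\<^sub>R \<xi>\<close> lie in the region of aperture 2, being at distance
  \<open>d\<close> from both \<open>\<xi>\<close> and the circle.\<close>

lemma has_nontangential_limit_unique:
  assumes xi: "\<xi> \<in> circle" and "has_nontangential_limit f \<xi> l" "has_nontangential_limit f \<xi> l'"
  shows "l = l'"
proof -
  let ?F = "at \<xi> within stolz_region 2 \<xi>"
  have "\<xi> islimpt stolz_region 2 \<xi>"
    unfolding islimpt_approachable
  proof (intro allI impI)
    fix e :: real assume e: "0 < e"
    define d where "d = min e 1 / 2"
    have d: "0 < d" "d < e" "d < 1" using e by (auto simp: d_def)
    let ?x = "(1 - d) *\<^sub>R \<xi>"
    have nx: "norm ?x = 1 - d" using xi d by simp
    have "?x - \<xi> = - d *\<^sub>R \<xi>" by (simp add: scaleR_diff_left)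
    then have dx: "norm (?x - \<xi>) = d" using xi d by simp
    show "\<exists>x'\<in>stolz_region 2 \<xi>. x' \<noteq> \<xi> \<and> dist x' \<xi> < e"
    proof (intro bexI conjI)
      show "?x \<in> stolz_region 2 \<xi>"
        unfolding stolz_region_def mem_Collect_eq nx dx using d by simp
      show "?x \<noteq> \<xi>" using dx d by (metis diff_self less_irrefl norm_zero)
      show "dist ?x \<xi> < e" using dx d by (simp add: dist_norm)
    qed
  qed
  then have "?F \<noteq> bot" by (simp add: trivial_limit_within)
  moreover have "(f \<longlongrightarrow> l) ?F" "(f \<longlongrightarrow> l') ?F"
    using assms(2,3) by (auto simp: has_nontangential_limit_def)
  ultimately show ?thesis by (rule tendsto_unique)
qed

text \<open>For a Lipschitz function the non-tangential limit exists at every point and is the value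
  there, which resolves both the case distinction and the definite description.\<close>

lemma local_dirichlet_lipschitz:
  assumes xi: "\<xi> \<in> circle"
    and u: "\<And>v w. v \<in> circle \<Longrightarrow> w \<in> circle \<Longrightarrow> norm (u v - u w) \<le> L * norm (v - w)"
  shows "local_dirichlet u \<xi> =
    (\<integral>\<^sup>+z. ennreal ((norm (u z - u \<xi>))\<^sup>2 / (norm (z - \<xi>))\<^sup>2) \<partial>circle_measure)"
proof -
  have lim: "has_nontangential_limit (poisson_integral u) \<xi> (u \<xi>)"
    by (rule poisson_nontangential_limit[OF xi u])
  moreover have "(THE l. has_nontangential_limit (poisson_integral u) \<xi> l) = u \<xi>"
    using lim has_nontangential_limit_unique[OF xi] by blast
  ultimately show ?thesis by (auto simp: local_dirichlet_def Let_def)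
qed

text \<open>Allows the unnormalised arc length as reference measure in the energy estimates.\<close>

lemma nn_integral_circle_measure_le:
  assumes "f \<in> borel_measurable arc_length"
  shows "(\<integral>\<^sup>+z. f z \<partial>circle_measure) \<le> (\<integral>\<^sup>+z. f z \<partial>arc_length)"
proof -
  have "(\<integral>\<^sup>+z. f z \<partial>circle_measure) = ennreal (1 / (2 * pi)) * (\<integral>\<^sup>+z. f z \<partial>arc_length)"
    unfolding circle_measure_def using assms by (rule nn_integral_scale_measure)
  also have "\<dots> \<le> 1 * (\<integral>\<^sup>+z. f z \<partial>arc_length)"
    using pi_ge_two by (intro mult_right_mono) auto
  finally show ?thesis by simp
qed

section \<open>Pointwise behaviour of the test function\<close>

context thin_set
begin

lemma sum_c_pos: "m < n \<Longrightarrow> 0 < sum c {m..<n}"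
  using c_pos by (intro sum_pos) auto

lemma test_fun_nonneg: "0 \<le> test_fun m n z"
  unfolding test_fun_def using c_pos
  by (intro divide_nonneg_nonneg sum_nonneg mult_nonneg_nonneg) (auto simp: less_imp_le)

lemma test_fun_le_1: "test_fun m n z \<le> 1"
proof (cases "m < n")
  case True
  have "(\<Sum>j\<in>{m..<n}. c j * bump (1 / 2 ^ j) (del z)) \<le> (\<Sum>j\<in>{m..<n}. c j * 1)"
    using c_pos by (intro sum_mono mult_left_mono) (auto simp: less_imp_le)
  then show ?thesis using sum_c_pos[OF True] by (simp add: test_fun_def)
qed (simp add: test_fun_def)

lemma test_fun_eq_1:
  assumes "m < n" "del z \<le> 1 / 2 ^ n"
  shows "test_fun m n z = 1"
proof -
  have "bump (1 / 2 ^ j) (del z) = 1" if "j \<in> {m..<n}" for j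
  proof (rule bump_eq_1)
    have "1 / 2 ^ n \<le> 1 / (2::real) ^ j" using that by (intro divide_left_mono power_increasing) auto
    then show "del z \<le> 1 / 2 ^ j" using assms by simp
  qed simp
  then have "(\<Sum>j\<in>{m..<n}. c j * bump (1 / 2 ^ j) (del z)) = sum c {m..<n}"
    by (intro sum.cong) auto
  then show ?thesis using sum_c_pos[OF assms(1)] by (simp add: test_fun_def)
qed

lemma test_fun_eq_0:
  assumes "2 / 2 ^ m \<le> del z"
  shows "test_fun m n z = 0"
proof -
  have "bump (1 / 2 ^ j) (del z) = 0" if "j \<in> {m..<n}" for j
  proof (rule bump_eq_0)
    have "2 / 2 ^ j \<le> 2 / (2::real) ^ m" using that by (intro divide_left_mono power_increasing) auto
    then show "2 * (1 / 2 ^ j) \<le> del z" using assms by simp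
  qed simp
  then have "(\<Sum>j\<in>{m..<n}. c j * bump (1 / 2 ^ j) (del z)) = 0"
    by (intro sum.neutral) auto
  then show ?thesis by (simp add: test_fun_def)
qed

text \<open>A Lipschitz constant, of whatever size, identifies the non-tangential limits of the
  Poisson integral with the values of the function.\<close>

lemma test_fun_lipschitz:
  "\<bar>test_fun m n z - test_fun m n w\<bar> \<le> (\<Sum>j\<in>{m..<n}. c j * 2 ^ j) / sum c {m..<n} * dist z w"
proof -
  have S: "0 \<le> sum c {m..<n}" using c_pos by (intro sum_nonneg) (auto simp: less_imp_le)
  have "\<bar>test_fun m n z - test_fun m n w\<bar>
    = \<bar>\<Sum>j\<in>{m..<n}. c j * (bump (1 / 2 ^ j) (del z) - bump (1 / 2 ^ j) (del w))\<bar> / sum c {m..<n}"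
    using S by (simp add: test_fun_def right_diff_distrib sum_subtractf flip: diff_divide_distrib)
  also have "\<dots> \<le> (\<Sum>j\<in>{m..<n}. c j * (2 ^ j * dist z w)) / sum c {m..<n}"
  proof (intro divide_right_mono S order_trans[OF sum_abs] sum_mono)
    fix j
    have "\<bar>bump (1 / 2 ^ j) (del z) - bump (1 / 2 ^ j) (del w)\<bar> \<le> \<bar>del z - del w\<bar> / (1 / 2 ^ j)"
      by (rule bump_lipschitz) simp
    also have "\<dots> \<le> dist z w / (1 / 2 ^ j)"
      using infdist_triangle_abs by (intro divide_right_mono) auto
    finally show "\<bar>c j * (bump (1 / 2 ^ j) (del z) - bump (1 / 2 ^ j) (del w))\<bar> \<le> c j * (2 ^ j * dist z w)"
      using c_pos[of j] by (simp add: abs_mult mult.commute)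
  qed
  finally show ?thesis by (simp add: sum_distrib_right mult.assoc)
qed

end

subsection \<open>Capacity of closed null sets\<close>

text \<open>Treated apart because \<open>infdist z {}\<close> is 0 by convention, so the distance
  function is uninformative. The zero function is a test function for the empty open set.\<close>

lemma capacity_empty:
  assumes "space \<mu> = circle"
  shows "capacity \<mu> {} = 0"
proof -
  let ?u = "\<lambda>_ :: complex. 0 :: complex"
  have "local_dirichlet ?u \<xi> = 0" if "\<xi> \<in> circle" for \<xi>
    using local_dirichlet_lipschitz[OF that, of ?u 0] by simp
  then have "dirichlet_integral \<mu> ?u = (\<integral>\<^sup>+\<xi>. 0 \<partial>\<mu>)"
    unfolding dirichlet_integral_def using assms by (intro nn_integral_cong) auto
  then have u: "dirichlet_norm_sq \<mu> ?u = 0"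
    by (simp add: dirichlet_norm_sq_def)
  then have "?u \<in> harmonic_dirichlet_space \<mu>"
    by (simp add: harmonic_dirichlet_space_def L2_circle_def)
  then have "open_capacity \<mu> {} \<le> dirichlet_norm_sq \<mu> ?u"
    unfolding open_capacity_def by (intro Inf_lower CollectI exI[of _ ?u]) simp
  moreover have "capacity \<mu> {} \<le> open_capacity \<mu> {}"
    unfolding capacity_def by (intro Inf_lower CollectI exI[of _ "{}"]) auto
  ultimately show ?thesis using u by simp
qed

section \<open>Admissible gauges and the dyadic form of the divergence condition\<close>

locale admissible_set =
  fixes \<mu> :: "complex measure" and E :: "complex set" and \<psi> :: "real \<Rightarrow> real" and \<alpha> :: real
  assumes sets_mu: "sets \<mu> = sets (restrict_space borel circle)" and finite: "finite_measure \<mu>"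
    and closed_E: "closed E" and E_circle: "E \<subseteq> circle" and E_ne: "E \<noteq> {}"
    and E_null: "emeasure arc_length E = 0"
    and adm: "admissible \<alpha> \<psi>" and alpha: "\<alpha> < 2"
    and modulus: "\<And>t. 0 < t \<Longrightarrow> t < 2 * pi \<Longrightarrow> local_modulus \<mu> E t \<le> ennreal (\<psi> t)"
begin

text \<open>An arc of half-length \<open>3 * pi / 2\<close> is the whole circle, so that the truncated gauge
  controls balls of every radius.\<close>

definition phi :: "real \<Rightarrow> real" where
  "phi r = \<psi> (min (2 * r) (3 * pi / 2))"

lemma psi_pos: "0 < t \<Longrightarrow> t < 2 * pi \<Longrightarrow> 0 < \<psi> t"
  using adm by (auto simp: admissible_def gauge_function_def)

lemma psi_mono: "0 < s \<Longrightarrow> s \<le> t \<Longrightarrow> t < 2 * pi \<Longrightarrow> \<psi> s \<le> \<psi> t"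
  using adm by (auto simp: admissible_def gauge_function_def mono_on_def)

lemma trunc_less: "min r (3 * pi / 2) < 2 * pi"
  by (rule min.strict_coboundedI2) simp

text \<open>Monotonicity of \<open>\<psi> s / s powr \<alpha>\<close> bounds
  \<open>\<psi> t / \<psi> s\<close> by \<open>(t / s) powr \<alpha>\<close>. The exponent
  \<open>max 1 \<alpha>\<close> makes the constant at least 2, while \<open>\<alpha> < 2\<close>
  keeps it below 4, as \<open>thin_set\<close> requires.\<close>

lemma psi_double:
  assumes s: "0 < s" "s \<le> t" "t < 2 * pi" "t \<le> 2 * s"
  shows "\<psi> t \<le> 2 powr max 1 \<alpha> * \<psi> s"
proof -
  have al: "0 < \<alpha>" and anti: "antimono_on {0<..<2*pi} (\<lambda>s. \<psi> s / s powr \<alpha>)"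
    using adm by (auto simp: admissible_def)
  have "\<psi> t / t powr \<alpha> \<le> \<psi> s / s powr \<alpha>"
    using anti s by (auto dest!: monotone_onD[where x = s and y = t])
  then have "\<psi> t \<le> \<psi> s * (t powr \<alpha> / s powr \<alpha>)"
    using s by (simp add: field_simps)
  also have "t powr \<alpha> / s powr \<alpha> = (t / s) powr \<alpha>"
    using s by (simp add: powr_divide)
  also have "\<psi> s * (t / s) powr \<alpha> \<le> \<psi> s * 2 powr max 1 \<alpha>"
  proof (intro mult_left_mono)
    have "(t / s) powr \<alpha> \<le> 2 powr \<alpha>" using s al by (intro powr_mono2) (auto simp: field_simps)
    also have "\<dots> \<le> 2 powr max 1 \<alpha>" by (intro powr_mono) auto
    finally show "(t / s) powr \<alpha> \<le> 2 powr max 1 \<alpha>" .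
  qed (use psi_pos[of s] s in auto)
  finally show ?thesis by (simp add: mult.commute)
qed

lemma space_mu: "space \<mu> = circle"
  using sets_eq_imp_space_eq[OF sets_mu] by (simp add: space_restrict_space)

sublocale thin_set \<mu> arc_length E phi 12 "2 powr max 1 \<alpha>"
proof (rule thin_set.intro)
  show "finite_measure \<mu>" "finite_measure arc_length"
    by (fact finite finite_measure_arc_length)+
  show "(\<lambda>x. x) \<in> borel_measurable \<mu>" "(\<lambda>x. x) \<in> borel_measurable arc_length"
    using id_measurable_circle
    by (simp_all cong: measurable_cong_sets add: sets_mu sets_arc_length)
  show "space arc_length = space \<mu>" by (simp add: space_mu)
  show "E \<subseteq> space \<mu>" "E \<noteq> {}" by (simp_all add: space_mu E_circle E_ne)
  show "0 < phi r" if "0 < r" for r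
    unfolding phi_def using that by (intro psi_pos trunc_less) auto
  show "phi r \<le> phi s" if "0 < r" "r \<le> s" for r s
    unfolding phi_def using that by (intro psi_mono trunc_less) auto
  \<comment> \<open>Truncating both arguments at the same value keeps their ratio at most 2.\<close>
  show "phi (2 * r) \<le> 2 powr max 1 \<alpha> * phi r" if "0 < r" for r
    unfolding phi_def using that using pi_gt_zero by (intro psi_double trunc_less; linarith)
  have "(2::real) powr 1 \<le> 2 powr max 1 \<alpha>" by (intro powr_mono) auto
  then show "2 \<le> (2::real) powr max 1 \<alpha>" by simp
  have "(2::real) powr max 1 \<alpha> < 2 powr 2" using alpha by (intro powr_less_mono) auto
  then show "(2::real) powr max 1 \<alpha> < 4" by simp
  show "emeasure \<mu> {x \<in> space \<mu>. dist x e < r} \<le> ennreal (phi r)" if e: "e \<in> E" and r: "0 < r" for e r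
  proof -
    let ?t = "min (2 * r) (3 * pi / 2)"
    have ec: "e \<in> circle" using e E_circle by auto
    have "{x \<in> space \<mu>. dist x e < r} \<subseteq> open_arc e ?t"
    proof clarify
      fix x assume x: "x \<in> space \<mu>" "dist x e < r"
      then have "arc_dist x e < 2 * r"
        using arc_dist_le[of x e] ec by (simp add: space_mu)
      moreover have "arc_dist x e \<le> pi"
        using Arg_bounded[of "x / e"] by (simp add: arc_dist_def abs_le_iff)
      then have "arc_dist x e < 3 * pi / 2" using pi_gt_zero by linarith
      ultimately show "x \<in> open_arc e ?t"
        using x ec by (simp add: open_arc_eq space_mu)
    qed
    then have "emeasure \<mu> {x \<in> space \<mu>. dist x e < r} \<le> emeasure \<mu> (open_arc e ?t)"
      using open_arc_in_sets[OF ec] by (intro emeasure_mono) (auto simp: sets_mu)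
    also have "\<dots> \<le> local_modulus \<mu> E ?t"
      unfolding local_modulus_def using e by (intro SUP_upper)
    also have "\<dots> \<le> ennreal (phi r)"
      unfolding phi_def using r by (intro modulus trunc_less) auto
    finally show ?thesis .
  qed
  show "emeasure arc_length {z \<in> space arc_length. dist z x < r} \<le> ennreal (12 * r)"
    if "x \<in> space \<mu>" "0 < r" for x r
    using arc_length_ball_le[of x r] that by (simp add: space_mu)
  show "ennreal r \<le> emeasure arc_length {z \<in> space arc_length. dist z x < r}"
    if "x \<in> space \<mu>" "0 < r" "r \<le> 1" for x r
    using arc_length_ball_ge[of x r] that by (simp add: space_mu)
qed simp

text \<open>The lower end \<open>8 * r \<le> t\<close> places the chordal neighbourhood of radius
  \<open>4 * r\<close> inside the arc neighbourhood, as arcs are at most twice their chords. The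
  upper end controls the division by \<open>t\<close>.\<close>

lemma M_fun_ge:
  assumes "0 < r" "8 * r \<le> t" "t < 16 * r" "t < 2 * pi"
  shows "ennreal (phi r * F (4 * r) / (16 * r)) \<le> M_fun \<psi> E t"
proof -
  interpret arc: finite_measure arc_length by (rule finite_measure_arc_length)
  have "F (4 * r) \<le> measure arc_length (arc_nbhd E t)"
    unfolding F_def
  proof (rule arc.finite_measure_mono)
    show "{z \<in> space arc_length. infdist z E < 4 * r} \<subseteq> arc_nbhd E t"
      using arc_nbhd_superset[OF E_circle E_ne, of "4 * r" t] assms by simp
    show "arc_nbhd E t \<in> sets arc_length"
      using assms by (simp add: sets_arc_length arc_nbhd_in_sets[OF closed_E E_circle E_ne])
  qed
  moreover have "phi r \<le> \<psi> t"
    unfolding phi_def using assms by (intro psi_mono) auto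
  ultimately have "phi r / (16 * r) * F (4 * r) \<le> \<psi> t / t * measure arc_length (arc_nbhd E t)"
    using assms psi_pos[of t] phi_pos[of r] F_pos[of "4 * r"]
    by (intro mult_mono frac_le) auto
  then show ?thesis
    unfolding M_fun_def by (intro max.coboundedI2 ennreal_leI) simp
qed

lemma dyadic_scale:
  assumes "0 < t" "t < pi"
  shows "\<exists>j. 8 / 2 ^ j \<le> t \<and> t < 16 / 2 ^ j"
proof -
  have ex: "\<exists>j. 8 / 2 ^ j \<le> t"
    using real_arch_pow[of 2 "8 / t"] assms by (auto simp: field_simps intro: less_imp_le)
  define j where "j = (LEAST j. 8 / 2 ^ j \<le> t)"
  have j: "8 / 2 ^ j \<le> t" unfolding j_def using ex by (rule LeastI_ex)
  \<comment> \<open>Index 0 would require \<open>8 \<le> t\<close>, contrary to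
    \<open>t < pi\<close>.\<close>
  have "j \<noteq> 0" using j assms pi_less_4 by (intro notI) simp
  then obtain k where k: "j = Suc k" by (cases j) auto
  have "\<not> 8 / 2 ^ k \<le> t"
    using not_less_Least[of k "\<lambda>j. 8 / 2 ^ j \<le> t"] k unfolding j_def by simp
  then have "t < 16 / 2 ^ j" using k by simp
  with j show ?thesis by blast
qed

text \<open>On the dyadic interval from \<open>8 / 2 ^ j\<close> to \<open>16 / 2 ^ j\<close> the
  reciprocal is at most the constant \<open>q j\<close> obtained from \<open>M_fun_ge\<close>.
  Multiplying by the length \<open>8 / 2 ^ j\<close> gives \<open>128 * c j\<close>.\<close>

lemma integral_inverse_M_le:
  "(\<integral>\<^sup>+t\<in>{0<..<pi}. 1 / M_fun \<psi> E t \<partial>lborel) \<le> (\<Sum>j. ennreal (128 * c j))"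
proof -
  define q where "q j = (16 / 2 ^ j) / (phi (1 / 2 ^ j) * F (4 / 2 ^ j))" for j :: nat
  have q: "0 < q j" for j
    unfolding q_def by (intro divide_pos_pos mult_pos_pos phi_pos F_pos) auto
  have "(\<integral>\<^sup>+t\<in>{0<..<pi}. 1 / M_fun \<psi> E t \<partial>lborel)
    \<le> (\<integral>\<^sup>+t. (\<Sum>j. ennreal (q j) * indicator {8 / 2 ^ j..<16 / 2 ^ j :: real} t) \<partial>lborel)"
  proof (intro nn_integral_mono)
    fix t :: real
    show "1 / M_fun \<psi> E t * indicator {0<..<pi} t
      \<le> (\<Sum>j. ennreal (q j) * indicator {8 / 2 ^ j..<16 / 2 ^ j :: real} t)"
    proof (cases "t \<in> {0<..<pi}")
      case True
      then obtain j where j: "8 / 2 ^ j \<le> t" "t < 16 / 2 ^ j"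
        using dyadic_scale[of t] by auto
      have "ennreal (1 / q j) \<le> M_fun \<psi> E t"
        using M_fun_ge[of "1 / 2 ^ j" t] j True by (simp add: q_def field_simps)
      then have "1 / M_fun \<psi> E t \<le> ennreal (q j)"
      proof (cases "M_fun \<psi> E t" rule: ennreal_cases)
        case (real x)
        assume "ennreal (1 / q j) \<le> M_fun \<psi> E t"
        then have x: "1 / q j \<le> x" using real by simp
        then have "0 < x" using q[of j] by (intro less_le_trans[OF _ x]) auto
        then have "1 / x \<le> q j" using x q[of j] by (simp add: field_simps)
        then show ?thesis
          using real \<open>0 < x\<close> divide_ennreal[of 1 x] by (simp add: ennreal_leI)
      qed simp
      also have "\<dots> = (\<Sum>i\<in>{j}. ennreal (q i) * indicator {8 / 2 ^ i..<16 / 2 ^ i} t)"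
        using j by (subst sum.insert) (simp_all del: sum_ennreal)
      also have "\<dots> \<le> (\<Sum>j. ennreal (q j) * indicator {8 / 2 ^ j..<16 / 2 ^ j :: real} t)"
        by (intro sum_le_suminf) auto
      finally show ?thesis using True by simp
    qed simp
  qed
  also have "\<dots> = (\<Sum>j. \<integral>\<^sup>+t. ennreal (q j) * indicator {8 / 2 ^ j..<16 / 2 ^ j :: real} t \<partial>lborel)"
    by (intro nn_integral_suminf) measurable
  also have "\<dots> = (\<Sum>j. ennreal (128 * c j))"
  proof (intro suminf_cong)
    fix j
    have "(\<integral>\<^sup>+t. ennreal (q j) * indicator {8 / 2 ^ j..<16 / 2 ^ j :: real} t \<partial>lborel)
      = ennreal (q j) * emeasure lborel {8 / 2 ^ j..<16 / (2::real) ^ j}"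
      by (intro nn_integral_cmult_indicator) simp
    also have "emeasure lborel {8 / 2 ^ j..<16 / (2::real) ^ j} = ennreal (8 / 2 ^ j)"
      by (simp add: divide_right_mono flip: diff_divide_distrib)
    also have "ennreal (q j) * ennreal (8 / 2 ^ j) = ennreal (q j * (8 / 2 ^ j))"
      using q[of j] by (intro ennreal_mult'[symmetric]) auto
    also have "q j * (8 / 2 ^ j) = 128 * c j"
      by (simp add: q_def c_def power2_eq_square)
    finally show "(\<integral>\<^sup>+t. ennreal (q j) * indicator {8 / 2 ^ j..<16 / 2 ^ j :: real} t \<partial>lborel) = ennreal (128 * c j)" .
  qed
  finally show ?thesis .
qed

text \<open>Discarding finitely many terms preserves divergence, so the coarsest scale
  \<open>m\<close> may be fixed before \<open>n\<close> is chosen.\<close>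

lemma sum_c_unbounded:
  assumes "(\<integral>\<^sup>+t\<in>{0<..<pi}. 1 / M_fun \<psi> E t \<partial>lborel) = \<infinity>"
  shows "\<exists>n>m. K < sum c {m..<n}"
proof (rule ccontr)
  assume "\<not> (\<exists>n>m. K < sum c {m..<n})"
  then have K: "sum c {m..<n} \<le> K" if "m < n" for n using that by force
  have bound: "sum c {..<n} \<le> sum c {..<m} + K" for n
  proof -
    \<comment> \<open>The range is enlarged so that it reaches beyond \<open>m\<close>, where the
      assumed bound \<open>K\<close> applies.\<close>
    have "sum c {..<n} \<le> sum c {..<max n (Suc m)}"
      using c_pos by (intro sum_mono2) (auto simp: less_imp_le)
    also have "{..<max n (Suc m)} = {..<m} \<union> {m..<max n (Suc m)}" by auto
    also have "sum c \<dots> = sum c {..<m} + sum c {m..<max n (Suc m)}"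
      by (rule sum.union_disjoint) auto
    also have "\<dots> \<le> sum c {..<m} + K" using K[of "max n (Suc m)"] by simp
    finally show ?thesis .
  qed
  have "summable c"
    using c_pos bound by (intro summableI_nonneg_bounded) (auto simp: less_imp_le)
  then have "summable (\<lambda>j. 128 * c j)" by (rule summable_mult)
  then have "(\<Sum>j. ennreal (128 * c j)) \<noteq> top"
    using c_pos by (intro ennreal_suminf_neq_top) (auto simp: less_imp_le)
  then show False
    using integral_inverse_M_le assms by (simp add: top_unique)
qed

section \<open>From energy to capacity\<close>

text \<open>Continuity from above: the neighbourhoods decrease to \<open>E\<close>, which is closed
  and null.\<close>

lemma F_dyadic_tendsto: "(\<lambda>m. F (2 / 2 ^ m)) \<longlonglongrightarrow> 0"
proof -
  interpret arc: finite_measure arc_length by (rule finite_measure_arc_length)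
  let ?V = "\<lambda>m :: nat. {z \<in> space arc_length. infdist z E < 2 / 2 ^ m}"
  have "decseq ?V"
  proof (rule antimonoI)
    fix m n :: nat assume "m \<le> n"
    then have "2 / 2 ^ n \<le> 2 / (2::real) ^ m" by (intro divide_left_mono power_increasing) auto
    then show "?V n \<subseteq> ?V m" by auto
  qed
  then have "(\<lambda>m. measure arc_length (?V m)) \<longlonglongrightarrow> measure arc_length (\<Inter>m. ?V m)"
    by (intro arc.finite_Lim_measure_decseq image_subsetI) measurable
  moreover have "(\<Inter>m. ?V m) = E"
  proof (intro subset_antisym subsetI)
    fix z assume z: "z \<in> (\<Inter>m. ?V m)"
    have "(\<lambda>m. 2 / (2::real) ^ m) \<longlonglongrightarrow> 0"
      using tendsto_mult_left[OF LIMSEQ_inverse_realpow_zero[of 2], of 2] by (simp add: divide_inverse)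
    then have "infdist z E \<le> 0"
      by (rule LIMSEQ_le_const) (use z in \<open>auto intro: less_imp_le\<close>)
    then have "infdist z E = 0" using infdist_nonneg[of z E] by simp
    then show "z \<in> E" using closed_E E_ne in_closed_iff_infdist_zero by blast
  next
    fix z assume "z \<in> E" then show "z \<in> (\<Inter>m. ?V m)" using E_circle by auto
  qed
  ultimately show ?thesis
    using E_null by (simp add: F_def measure_def)
qed

text \<open>The test function is 1 on the open neighbourhood of radius \<open>1 / 2 ^ n\<close>, so
  it competes in the capacity of that set. It takes values in the unit interval and vanishes beyond
  \<open>2 / 2 ^ m\<close>, which gives the first summand; the second is its energy.\<close>

lemma capacity_le:
  assumes "1 \<le> m" "m < n"
  shows "capacity \<mu> E \<le> ennreal (F (2 / 2 ^ m) + 16 * A / (4 - 2 powr max 1 \<alpha>) / sum c {m..<n})"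
proof -
  let ?v = "test_fun m n"
  define u where "u z = complex_of_real (?v z)" for z
  define L where "L = (\<Sum>j\<in>{m..<n}. c j * 2 ^ j) / sum c {m..<n}"
  have uL: "norm (u z - u w) \<le> L * norm (z - w)" for z w
    using test_fun_lipschitz[of m n z w]
    by (simp add: u_def L_def dist_norm flip: of_real_diff)
  have L: "0 \<le> L" unfolding L_def using c_pos
    by (intro divide_nonneg_nonneg sum_nonneg) (auto simp: less_imp_le)
  have "L-lipschitz_on circle u"
    using uL L by (intro lipschitz_onI) (auto simp: dist_norm)
  then have cu: "continuous_on circle u" by (rule lipschitz_on_continuous_on)
  note um [measurable] = continuous_circle_measurable[OF cu]
  have L2: "(\<integral>\<^sup>+z. ennreal ((norm (u z))\<^sup>2) \<partial>circle_measure) \<le> ennreal (F (2 / 2 ^ m))"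
  proof -
    have "(\<integral>\<^sup>+z. ennreal ((norm (u z))\<^sup>2) \<partial>circle_measure)
      \<le> (\<integral>\<^sup>+z. ennreal ((norm (u z))\<^sup>2) \<partial>arc_length)"
      by (intro nn_integral_circle_measure_le) measurable
    also have "\<dots> \<le> (\<integral>\<^sup>+z. indicator {z \<in> space arc_length. infdist z E < 2 / 2 ^ m} z \<partial>arc_length)"
    proof (intro nn_integral_mono)
      fix z assume z: "z \<in> space arc_length"
      have "(norm (u z))\<^sup>2 \<le> indicator {z \<in> space arc_length. infdist z E < 2 / 2 ^ m} z"
      proof (cases "infdist z E < 2 / 2 ^ m")
        case True
        have "(?v z)\<^sup>2 \<le> 1\<^sup>2" by (intro power_mono test_fun_le_1 test_fun_nonneg)
        then show ?thesis using True z by (simp add: u_def)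
      next
        case False
        then show ?thesis using test_fun_eq_0[of m z n] by (simp add: u_def)
      qed
      then show "ennreal ((norm (u z))\<^sup>2) \<le> indicator {z \<in> space arc_length. infdist z E < 2 / 2 ^ m} z"
        by (metis ennreal_indicator ennreal_leI)
    qed
    also have "\<dots> = ennreal (F (2 / 2 ^ m))"
      by (simp add: emeasure_F del: space_arc_length)
    finally show ?thesis .
  qed
  have D: "dirichlet_integral \<mu> u \<le> ennreal (16 * A / (4 - 2 powr max 1 \<alpha>) / sum c {m..<n})"
  proof -
    have "dirichlet_integral \<mu> u \<le>
      (\<integral>\<^sup>+x. \<integral>\<^sup>+z. ennreal ((?v z - ?v x)\<^sup>2 / (dist z x)\<^sup>2) \<partial>arc_length \<partial>\<mu>)"
      unfolding dirichlet_integral_def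
    proof (intro nn_integral_mono)
      fix x assume "x \<in> space \<mu>"
      then have x: "x \<in> circle" by (simp add: space_mu)
      have "local_dirichlet u x =
        (\<integral>\<^sup>+z. ennreal ((norm (u z - u x))\<^sup>2 / (norm (z - x))\<^sup>2) \<partial>circle_measure)"
        by (rule local_dirichlet_lipschitz[OF x uL])
      also have "\<dots> \<le> (\<integral>\<^sup>+z. ennreal ((norm (u z - u x))\<^sup>2 / (norm (z - x))\<^sup>2) \<partial>arc_length)"
        by (intro nn_integral_circle_measure_le) measurable
      also have "\<dots> = (\<integral>\<^sup>+z. ennreal ((?v z - ?v x)\<^sup>2 / (dist z x)\<^sup>2) \<partial>arc_length)"
        by (simp add: u_def dist_norm flip: of_real_diff)
      finally show "local_dirichlet u x \<le> (\<integral>\<^sup>+z. ennreal ((?v z - ?v x)\<^sup>2 / (dist z x)\<^sup>2) \<partial>arc_length)" .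
    qed
    also have "\<dots> \<le> ennreal (16 * A / (4 - 2 powr max 1 \<alpha>) / sum c {m..<n})"
      using assms by (rule energy_test_fun)
    finally show ?thesis .
  qed
  have nonneg: "0 \<le> F (2 / 2 ^ m)" "0 \<le> 16 * A / (4 - 2 powr max 1 \<alpha>) / sum c {m..<n}"
    using A_pos D_less sum_c_pos[OF assms(2)] by (auto simp: F_def)
  have norm: "dirichlet_norm_sq \<mu> u \<le> ennreal (F (2 / 2 ^ m) + 16 * A / (4 - 2 powr max 1 \<alpha>) / sum c {m..<n})"
    unfolding dirichlet_norm_sq_def ennreal_plus[OF nonneg] by (intro add_mono L2 D)
  have "u \<in> L2_circle"
    unfolding L2_circle_def using L2 um(1) by (auto simp: top_unique less_top intro: le_less_trans)
  moreover have "dirichlet_norm_sq \<mu> u < \<infinity>"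
    using norm by (auto intro: le_less_trans)
  ultimately have H: "u \<in> harmonic_dirichlet_space \<mu>"
    by (simp add: harmonic_dirichlet_space_def)
  define U where "U = circle \<inter> {z. infdist z E < 1 / 2 ^ n}"
  have "open {z. infdist z E < 1 / 2 ^ n}"
    by (intro open_Collect_less continuous_intros)
  then have U: "openin (top_of_set circle) U" unfolding U_def by (rule openin_open_Int)
  have EU: "E \<subseteq> U" using E_circle by (auto simp: U_def)
  have "capacity \<mu> E \<le> open_capacity \<mu> U"
    unfolding capacity_def using U EU by (intro Inf_lower) auto
  also have "\<dots> \<le> dirichlet_norm_sq \<mu> u"
    unfolding open_capacity_def
  proof (intro Inf_lower CollectI exI[of _ u] conjI refl H AE_I2 impI)
    fix z
    show "u z \<in> \<real>" "0 \<le> Re (u z)" by (simp_all add: u_def test_fun_nonneg)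
    assume "z \<in> U"
    then show "1 \<le> Re (u z)" using test_fun_eq_1[OF assms(2), of z] by (simp add: U_def u_def)
  qed
  finally show ?thesis using norm by (rule order_trans)
qed

text \<open>First \<open>m\<close> is chosen to make the mass of the neighbourhood small, then
  \<open>n\<close>, depending on \<open>m\<close>, to make the energy small.\<close>

lemma capacity_eq_0:
  assumes "(\<integral>\<^sup>+t\<in>{0<..<pi}. 1 / M_fun \<psi> E t \<partial>lborel) = \<infinity>"
  shows "capacity \<mu> E = 0"
proof -
  have "capacity \<mu> E \<le> 0 + ennreal e" if e: "0 < e" for e
  proof -
    have "\<forall>\<^sub>F m in sequentially. F (2 / 2 ^ m) < e / 2"
      using F_dyadic_tendsto e by (intro order_tendstoD(2)) auto
    then obtain m where m: "1 \<le> m" "F (2 / 2 ^ m) < e / 2"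
      unfolding eventually_sequentially by (metis le_trans nat_le_linear)
    define B where "B = 16 * A / (4 - 2 powr max 1 \<alpha>)"
    have B: "0 < B" using A_pos D_less by (simp add: B_def)
    obtain n where n: "m < n" "B / (e / 2) < sum c {m..<n}"
      using sum_c_unbounded[OF assms] by blast
    then have "B / sum c {m..<n} < e / 2"
      using e B sum_c_pos[OF n(1)] by (simp add: field_simps)
    then have "F (2 / 2 ^ m) + B / sum c {m..<n} \<le> e" using m by linarith
    then show ?thesis
      using capacity_le[OF m(1) n(1)] unfolding B_def by (auto intro: order_trans ennreal_leI)
  qed
  then have "capacity \<mu> E \<le> 0" by (rule ennreal_le_epsilon) auto
  then show ?thesis by simp
qed

end

theorem theorem5p4:
  fixes \<mu> :: "complex measure" and E :: "complex set"
    and \<psi> :: "real \<Rightarrow> real" and \<alpha> :: real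
  assumes "sets \<mu> = sets (restrict_space borel circle)" and "finite_measure \<mu>"
    and "closed E" and "E \<subseteq> circle" and "emeasure arc_length E = 0"
    and "admissible \<alpha> \<psi>" and "\<alpha> < 2"
    and "\<And>t. 0 < t \<Longrightarrow> t < 2 * pi \<Longrightarrow> local_modulus \<mu> E t \<le> ennreal (\<psi> t)"
    and "(\<integral>\<^sup>+t\<in>{0<..<pi}. 1 / M_fun \<psi> E t \<partial>lborel) = \<infinity>"
  shows "capacity \<mu> E = 0"
proof (cases "E = {}")
  case True
  have "space \<mu> = circle"
    using sets_eq_imp_space_eq[OF assms(1)] by (simp add: space_restrict_space)
  then show ?thesis using True by (simp add: capacity_empty)
next
  case False
  interpret admissible_set \<mu> E \<psi> \<alpha>
    by (rule admissible_set.intro) (fact assms False)+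
  show ?thesis using assms(9) by (rule capacity_eq_0)
qed

end
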